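(* Let $R=k[x_1,\ldots,x_d]$, $d\ge 2$, be a polynomial ring over a field $k$ with its standard grading, and let $M$ be a nonzero finitely generated graded $R$-module generated in degree $a\ge 0$ (i.e. $M$ is generated by its homogeneous elements of degree $a$). If $M$ is torsion-free, then $e_1(M)\le a\,e_0(M)$, with equality if and only if $M$ is a free $R$-module.
   Context: For a finitely generated graded module $M$ of dimension $d$ over $R=k[x_1,\dots,x_d]$ (each $x_i$ of degree $1$), the Hilbert coefficients $e_i(M)$, $0\le i\le d$, of the native grading of $M$ are the integers determined by $$\sum_{j\le n}\dim_k M_j=\sum_{i=0}^{d}(-1)^i e_i(M)\binom{n+d-i}{d-i}\qquad\text{for all } n\gg 0,$$ where $M_j$ is the degree-$j$ component of $M$. *)

theory Defs
  imports Complex_Main "HOL-Library.Poly_Mapping" "HOL-Library.Cardinality"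
begin

text \<open>
  The polynomial ring \<open>k[x\<^sub>1, \<dots>, x\<^sub>d]\<close>: finitely supported functions from exponent vectors to
  \<open>'k\<close> with convolution as multiplication. The variables are the elements of the finite type
  \<open>'v\<close>, so \<open>d = CARD('v)\<close>.
\<close>
type_synonym ('v, 'k) mpoly = "('v \<Rightarrow>\<^sub>0 nat) \<Rightarrow>\<^sub>0 'k"

definition monom_degree :: "('v::finite \<Rightarrow>\<^sub>0 nat) \<Rightarrow> nat" where
  "monom_degree t = (\<Sum>x\<in>UNIV. Poly_Mapping.lookup t x)"

definition homogeneous_polys :: "nat \<Rightarrow> ('v::finite, 'k::zero) mpoly set" where
  "homogeneous_polys i = {p. \<forall>t\<in>Poly_Mapping.keys p. monom_degree t = i}"

text \<open>
  The module is the whole type \<open>'m\<close>. Closure of \<open>Mg j\<close> under negation and under scalars from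
  \<open>'k\<close> is the case \<open>i = 0\<close> of \<open>graded_scale\<close>.
\<close>
locale graded_module = module scale
  for scale :: "('v::finite, 'k::field) mpoly \<Rightarrow> 'm::ab_group_add \<Rightarrow> 'm" +
  fixes Mg :: "int \<Rightarrow> 'm set"
  assumes graded_zero: "0 \<in> Mg j"
    and graded_add: "m \<in> Mg j \<Longrightarrow> m' \<in> Mg j \<Longrightarrow> m + m' \<in> Mg j"
    and graded_scale: "p \<in> homogeneous_polys i \<Longrightarrow> m \<in> Mg j \<Longrightarrow> scale p m \<in> Mg (int i + j)"
    and direct_sum: "\<exists>!f. (\<forall>j. f j \<in> Mg j) \<and> finite {j. f j \<noteq> 0} \<and> m = (\<Sum>j | f j \<noteq> 0. f j)"
begin

sublocale base: vector_space "\<lambda>c. scale (Poly_Mapping.single 0 c)"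
  by unfold_locales
    (simp_all add: scale_right_distrib scale_left_distrib single_add mult_single)

text \<open>
  In the sum only the nonzero components are kept, since the index set \<open>{j. j \<le> int n}\<close> is
  infinite; for a finitely generated module the remaining index set is finite.
\<close>
definition hilbert_sum :: "nat \<Rightarrow> nat" where
  "hilbert_sum n = (\<Sum>j | j \<le> int n \<and> Mg j \<noteq> {0}. base.dim (Mg j))"

definition hilbert_coeffs :: "(nat \<Rightarrow> int) \<Rightarrow> bool" where
  "hilbert_coeffs e \<longleftrightarrow>
     (\<forall>\<^sub>F n in sequentially.
        int (hilbert_sum n) =
          (\<Sum>i\<le>CARD('v). (-1) ^ i * e i * int ((n + CARD('v) - i) choose (CARD('v) - i))))"

text \<open>Only \<open>e i\<close> with \<open>i \<le> d\<close> are constrained; the others are set to 0 to make \<open>e\<close> unique.\<close>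
definition hilbert_coeff :: "nat \<Rightarrow> int" where
  "hilbert_coeff = (THE e. hilbert_coeffs e \<and> (\<forall>i>CARD('v). e i = 0))"

definition finitely_generated :: bool where
  "finitely_generated \<longleftrightarrow> (\<exists>S. finite S \<and> span S = UNIV)"

definition generated_in_degree :: "int \<Rightarrow> bool" where
  "generated_in_degree a \<longleftrightarrow> span (Mg a) = UNIV"

definition torsion_free :: bool where
  "torsion_free \<longleftrightarrow> (\<forall>p m. scale p m = 0 \<longrightarrow> p = 0 \<or> m = 0)"

definition free :: bool where
  "free \<longleftrightarrow> (\<exists>B. independent B \<and> span B = UNIV)"

end

end

theory Submission
  imports Defs "HOL-Computational_Algebra.Primes" "HOL-Library.FuncSet" "HOL-Library.Infinite_Set"
begin

text \<open>
  Choose a finite generating set \<open>G\<close> in degree \<open>a\<close> and a maximal linearly independent \<open>B \<subseteq> G\<close>. The free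
  module spanned by \<open>B\<close> contributes \<open>e\<^sub>0 = card B\<close> and \<open>e\<^sub>1 = a e\<^sub>0\<close>. Adding the remaining generators
  one at a time, each \<open>g\<close> contributes \<open>R / (N : g)\<close>, where \<open>N\<close> is the span so far; its Hilbert function counts the
  monomials that are not leading monomials of the nonzero ideal \<open>(N : g)\<close>. By Dickson's lemma such counts are
  eventually polynomial, of degree less than \<open>d\<close>, so \<open>e\<^sub>1\<close> can only decrease.

  If \<open>e\<^sub>1\<close> does not decrease, then for every variable some leading monomial avoids it. Let \<open>N\<close> be free and
  \<open>p g = \<Sum> u\<^sub>b b\<close> with \<open>p \<noteq> 0\<close>. Comparing leading monomials shows \<open>p dvd u\<^sub>b\<close>, and torsion-freeness gives
  \<open>g \<in> N\<close>. Hence equality makes \<open>B\<close> a basis. Conversely, if the module is free, graded Nakayama shows that a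
  basis of the degree \<open>a\<close> component over the ground field is a basis over \<open>R\<close>.
\<close>

section \<open>Hilbert polynomials\<close>

text \<open>The right side of \<open>hilbert_coeffs\<close> with the number of variables as a
  parameter \<open>d\<close>, so that induction on \<open>d\<close> is possible.\<close>

definition hpoly :: "nat \<Rightarrow> (nat \<Rightarrow> int) \<Rightarrow> nat \<Rightarrow> int" where
  "hpoly d e n = (\<Sum>i\<le>d. (-1) ^ i * e i * int ((n + d - i) choose (d - i)))"

lemma hpoly_0 [simp]: "hpoly 0 e n = e 0"
  by (simp add: hpoly_def)

lemma hpoly_Suc: "hpoly (Suc d) e n = e 0 * int ((n + Suc d) choose Suc d) - hpoly d (\<lambda>i. e (Suc i)) n"
  unfolding hpoly_def by (subst sum.atMost_Suc_shift) (simp add: sum_negf)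

lemma hpoly_add: "hpoly d (\<lambda>i. e i + e' i) n = hpoly d e n + hpoly d e' n"
  unfolding hpoly_def by (simp add: algebra_simps sum.distrib)

lemma hpoly_uminus: "hpoly d (\<lambda>i. - e i) n = - hpoly d e n"
  unfolding hpoly_def by (simp add: sum_negf)

lemma hpoly_diff: "hpoly d (\<lambda>i. e i - e' i) n = hpoly d e n - hpoly d e' n"
  unfolding hpoly_def by (simp add: algebra_simps sum_subtractf)

lemma hpoly_cong: "(\<And>i. i \<le> d \<Longrightarrow> e i = e' i) \<Longrightarrow> hpoly d e n = hpoly d e' n"
  unfolding hpoly_def by simp

lemma hpoly_binomial: "hpoly d (\<lambda>i. if i = 0 then c else 0) n = c * int ((n + d) choose d)"
proof (cases d)
  case 0
  then show ?thesis by simp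
next
  case (Suc d')
  have "hpoly d' (\<lambda>i. 0) n = 0" by (simp add: hpoly_def)
  with Suc show ?thesis by (simp add: hpoly_Suc)
qed

text \<open>Pascal's rule in every summand. The summand with \<open>i = Suc d\<close> is constant in
  \<open>n\<close>, so it drops out of the difference and the remaining coefficients keep their
  places.\<close>

lemma hpoly_step: "hpoly (Suc d) e (Suc n) - hpoly (Suc d) e n = hpoly d e (Suc n)"
proof -
  have *: "int ((Suc n + Suc d - i) choose (Suc d - i)) - int ((n + Suc d - i) choose (Suc d - i))
      = int ((Suc n + d - i) choose (d - i))" if "i \<le> d" for i
  proof -
    obtain k where "d = i + k" using \<open>i \<le> d\<close> by (auto simp: le_iff_add)
    then have "Suc n + Suc d - i = Suc (Suc (n + k))" "Suc d - i = Suc k" "n + Suc d - i = Suc (n + k)"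
      "Suc n + d - i = Suc (n + k)" "d - i = k" by simp_all
    then show ?thesis by simp
  qed
  have "hpoly (Suc d) e (Suc n) - hpoly (Suc d) e n = (\<Sum>i\<le>d. (-1) ^ i * e i *
      (int ((Suc n + Suc d - i) choose (Suc d - i)) - int ((n + Suc d - i) choose (Suc d - i))))"
    unfolding hpoly_def by (simp add: algebra_simps sum_subtractf)
  also have "\<dots> = hpoly d e (Suc n)"
    unfolding hpoly_def by (intro sum.cong refl) (simp only: * atMost_iff)
  finally show ?thesis .
qed

text \<open>Induction on \<open>d\<close>: the first difference is eventually at least 1, so from
  some point on the values grow at least linearly.\<close>

lemma hpoly_eventually_pos:
  assumes "e 0 \<ge> 1"
  shows "\<forall>\<^sub>F n in sequentially. hpoly d e n \<ge> 1"
proof (induction d)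
  case 0
  then show ?case using assms by simp
next
  case (Suc d)
  then obtain N where N: "\<And>n. n \<ge> N \<Longrightarrow> hpoly d e n \<ge> 1"
    by (auto simp: eventually_sequentially)
  define c where "c = hpoly (Suc d) e N"
  have grow: "hpoly (Suc d) e (N + k) \<ge> c + int k" for k
  proof (induction k)
    case 0
    then show ?case by (simp add: c_def)
  next
    case (Suc k)
    then show ?case using hpoly_step[of d e "N + k"] N[of "Suc (N + k)"] by simp
  qed
  have "hpoly (Suc d) e n \<ge> 1" if "n \<ge> N + nat (1 - c)" for n
    using grow[of "n - N"] that by simp
  then show ?case by (auto simp: eventually_sequentially)
qed

text \<open>Applied to a difference, this turns an eventual inequality between counts into an
  inequality between leading coefficients.\<close>

lemma hpoly_nonneg_lead:
  assumes "\<forall>\<^sub>F n in sequentially. hpoly d e n \<ge> 0"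
  shows "e 0 \<ge> 0"
proof (rule ccontr)
  assume "\<not> e 0 \<ge> 0"
  then have "\<forall>\<^sub>F n in sequentially. hpoly d (\<lambda>i. - e i) n \<ge> 1"
    by (intro hpoly_eventually_pos) simp
  with assms have "\<forall>\<^sub>F n in sequentially. False"
    by eventually_elim (simp add: hpoly_uminus)
  then show False by simp
qed

text \<open>Uniqueness of Hilbert coefficients: the leading one is both nonnegative and nonpositive,
  and once it is removed a polynomial for \<open>d - 1\<close> remains.\<close>

lemma hpoly_eventually_zero:
  assumes "\<forall>\<^sub>F n in sequentially. hpoly d e n = 0" "i \<le> d"
  shows "e i = 0"
  using assms
proof (induction d arbitrary: e i)
  case 0
  then show ?case by simp
next
  case (Suc d)
  have "\<forall>\<^sub>F n in sequentially. hpoly (Suc d) e n \<ge> 0"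
    using Suc.prems(1) by eventually_elim simp
  moreover have "\<forall>\<^sub>F n in sequentially. hpoly (Suc d) (\<lambda>i. - e i) n \<ge> 0"
    using Suc.prems(1) by eventually_elim (simp add: hpoly_uminus)
  ultimately have e0: "e 0 = 0"
    using hpoly_nonneg_lead[of "Suc d" e] hpoly_nonneg_lead[of "Suc d" "\<lambda>i. - e i"] by linarith
  have "\<forall>\<^sub>F n in sequentially. hpoly d (\<lambda>i. e (Suc i)) n = 0"
    using Suc.prems(1) by eventually_elim (simp add: hpoly_Suc e0)
  from Suc.IH[OF this] have "e (Suc j) = 0" if "j \<le> d" for j using that by simp
  with e0 Suc.prems(2) show ?case by (cases i) auto
qed

text \<open>Moving the generators up by \<open>b\<close> degrees adds \<open>b * e 0\<close> to the
  next coefficient. This is the source of the term \<open>a * e 0\<close> in the theorem.\<close>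

lemma hpoly_shift:
  "\<exists>e'. e' 0 = e 0 \<and> e' 1 = e 1 + int b * e 0 \<and> (\<forall>n. hpoly d e' (n + b) = hpoly d e n)"
proof (induction b)
  case 0
  then show ?case by auto
next
  case (Suc b)
  then obtain e' where e': "e' 0 = e 0" "e' 1 = e 1 + int b * e 0"
    "\<And>n. hpoly d e' (n + b) = hpoly d e n" by blast
  \<comment> \<open>For a shift by one, the value at \<open>n\<close> is the value at
    \<open>Suc n\<close> minus the first difference there. The alternating signs turn this
    subtraction into adding the coefficient sequence moved one place to the right.\<close>
  define f where "f = (\<lambda>i. e' i + (if i = 0 then 0 else e' (i - 1)))"
  have "hpoly d f (Suc n) = hpoly d e' n" for n
  proof (cases d)
    case 0
    then show ?thesis by (simp add: f_def)
  next
    case (Suc d')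
    have "hpoly d (\<lambda>i. if i = 0 then 0 else e' (i - 1)) (Suc n) = - hpoly d' e' (Suc n)"
      by (simp add: Suc hpoly_Suc)
    then have "hpoly d f (Suc n) = hpoly d e' (Suc n) - hpoly d' e' (Suc n)"
      unfolding f_def by (simp add: hpoly_add)
    then show ?thesis using hpoly_step[of d' e' n] Suc by simp
  qed
  then have "hpoly d f (n + Suc b) = hpoly d e n" for n using e'(3) by simp
  moreover have "f 0 = e 0" "f 1 = e 1 + int (Suc b) * e 0"
    using e'(1,2) by (simp_all add: f_def algebra_simps)
  ultimately show ?case by blast
qed

lemma eventually_hpoly_shift:
  assumes "\<forall>\<^sub>F n in sequentially. f n = hpoly d e n"
  obtains e' where "e' 0 = e 0" "e' 1 = e 1 + int b * e 0"
    "\<forall>\<^sub>F n in sequentially. f (n - b) = hpoly d e' n"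
proof -
  obtain e' where e': "e' 0 = e 0" "e' 1 = e 1 + int b * e 0"
    "\<And>n. hpoly d e' (n + b) = hpoly d e n" using hpoly_shift[of e b d] by blast
  obtain N where N: "\<And>n. n \<ge> N \<Longrightarrow> f n = hpoly d e n"
    using assms by (auto simp: eventually_sequentially)
  have "f (n - b) = hpoly d e' n" if "n \<ge> N + b" for n
    using N[of "n - b"] e'(3)[of "n - b"] that by simp
  then have "\<forall>\<^sub>F n in sequentially. f (n - b) = hpoly d e' n"
    by (auto simp: eventually_sequentially)
  with e' that show ?thesis by blast
qed

section \<open>Monomials\<close>

lemma monom_degree_0 [simp]: "monom_degree 0 = 0"
  by (simp add: monom_degree_def)

lemma monom_degree_add: "monom_degree (s + t) = monom_degree s + monom_degree t"
  by (simp add: monom_degree_def lookup_add sum.distrib)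

lemma monom_degree_single [simp]: "monom_degree (Poly_Mapping.single x k) = k"
  by (simp add: monom_degree_def lookup_single when_def)

lemma monom_degree_eq_0_iff: "monom_degree t = 0 \<longleftrightarrow> t = 0"
  by (simp add: monom_degree_def poly_mapping_eq_iff fun_eq_iff)

lemma lookup_le_monom_degree: "Poly_Mapping.lookup t x \<le> monom_degree t"
  unfolding monom_degree_def by (rule member_le_sum) simp_all

lemma finite_monom_degree_le: "finite {t :: 'v::finite \<Rightarrow>\<^sub>0 nat. monom_degree t \<le> n}"
proof (rule finite_imageD)
  have "Poly_Mapping.lookup t \<in> Pi\<^sub>E UNIV (\<lambda>_. {..n})" if "monom_degree t \<le> n" for t :: "'v \<Rightarrow>\<^sub>0 nat"
    using that order_trans[OF lookup_le_monom_degree] by (auto simp: PiE_UNIV_domain)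
  then have "Poly_Mapping.lookup ` {t :: 'v \<Rightarrow>\<^sub>0 nat. monom_degree t \<le> n} \<subseteq> Pi\<^sub>E UNIV (\<lambda>_. {..n})"
    by blast
  then show "finite (Poly_Mapping.lookup ` {t :: 'v \<Rightarrow>\<^sub>0 nat. monom_degree t \<le> n})"
    by (rule finite_subset) (intro finite_PiE; simp)
  show "inj_on Poly_Mapping.lookup {t :: 'v \<Rightarrow>\<^sub>0 nat. monom_degree t \<le> n}"
    by (simp add: inj_on_def poly_mapping.lookup_inject)
qed

lemma finite_monom_degree_eq: "finite {t :: 'v::finite \<Rightarrow>\<^sub>0 nat. monom_degree t = n}"
  by (rule finite_subset[OF _ finite_monom_degree_le[of n]]) auto

lemma add_minus_monom:
  assumes "\<And>x. Poly_Mapping.lookup s x \<le> Poly_Mapping.lookup t x"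
  shows "s + (t - s) = (t :: 'v \<Rightarrow>\<^sub>0 nat)"
  using assms by (intro poly_mapping_eqI) (simp add: lookup_add lookup_minus)

text \<open>A monomial in the variables of \<open>insert x A\<close> either avoids \<open>x\<close>
  or is \<open>x\<close> times a monomial of degree one less. This is Pascal's recursion.\<close>

lemma card_monoms_supported:
  assumes "finite A"
  shows "card {t :: 'v::finite \<Rightarrow>\<^sub>0 nat. Poly_Mapping.keys t \<subseteq> A \<and> monom_degree t \<le> n} = (n + card A) choose card A"
  using assms
proof (induction A arbitrary: n rule: finite_induct)
  case empty
  have "{t :: 'v \<Rightarrow>\<^sub>0 nat. Poly_Mapping.keys t \<subseteq> {} \<and> monom_degree t \<le> n} = {0}"
    by (auto simp: monom_degree_def poly_mapping_eq_iff fun_eq_iff in_keys_iff)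
  then show ?case by simp
next
  case (insert x A)
  define S where "S = (\<lambda>B n. {t :: 'v \<Rightarrow>\<^sub>0 nat. Poly_Mapping.keys t \<subseteq> B \<and> monom_degree t \<le> n})"
  have fin: "finite (S B n)" for B n
    unfolding S_def by (rule finite_subset[OF _ finite_monom_degree_le[of n]]) auto
  have S0: "S (insert x A) 0 = {0}"
    unfolding S_def by (auto simp: monom_degree_eq_0_iff)
  have IH: "card (S A n) = (n + card A) choose card A" for n
    using insert.IH unfolding S_def .
  have split: "S (insert x A) (Suc n) = S A (Suc n) \<union> (+) (Poly_Mapping.single x 1) ` S (insert x A) n" for n
  proof (intro equalityI subsetI)
    fix t assume t: "t \<in> S (insert x A) (Suc n)"
    show "t \<in> S A (Suc n) \<union> (+) (Poly_Mapping.single x 1) ` S (insert x A) n"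
    proof (cases "x \<in> Poly_Mapping.keys t")
      case True
      then have eq: "Poly_Mapping.single x 1 + (t - Poly_Mapping.single x 1) = t"
        by (intro add_minus_monom) (auto simp: lookup_single when_def in_keys_iff)
      have "monom_degree t = 1 + monom_degree (t - Poly_Mapping.single x 1)"
        by (subst eq[symmetric], subst monom_degree_add) simp
      moreover have "Poly_Mapping.keys (t - Poly_Mapping.single x 1) \<subseteq> Poly_Mapping.keys t"
        by (auto simp: in_keys_iff lookup_minus)
      ultimately have "t - Poly_Mapping.single x 1 \<in> S (insert x A) n"
        using t unfolding S_def by auto
      then show ?thesis using eq by (metis UnI2 image_eqI)
    next
      case False
      then show ?thesis using t unfolding S_def by auto
    qed
  next
    fix t assume "t \<in> S A (Suc n) \<union> (+) (Poly_Mapping.single x 1) ` S (insert x A) n"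
    then show "t \<in> S (insert x A) (Suc n)"
      unfolding S_def by (auto simp: monom_degree_add dest!: subsetD[OF keys_add] split: if_splits)
  qed
  have disj: "S A (Suc n) \<inter> (+) (Poly_Mapping.single x 1) ` S (insert x A) n = {}" for n
  proof -
    have "x \<in> Poly_Mapping.keys (Poly_Mapping.single x (1::nat) + t)" for t
      by (simp add: in_keys_iff lookup_add)
    then have "Poly_Mapping.single x 1 + t \<notin> S A (Suc n)" for t
      using insert.hyps unfolding S_def by blast
    then show ?thesis by blast
  qed
  have "card (S (insert x A) n) = (n + Suc (card A)) choose Suc (card A)" for n
  proof (induction n)
    case 0
    then show ?case by (simp add: S0)
  next
    case (Suc n)
    have "card (S (insert x A) (Suc n)) = card (S A (Suc n)) + card (S (insert x A) n)"
      unfolding split card_Un_disjoint[OF fin finite_imageI[OF fin] disj] by (simp add: card_image)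
    then show ?case using IH[of "Suc n"] Suc.IH by simp
  qed
  then show ?case using insert.hyps unfolding S_def by simp
qed

lemma card_monoms: "card {t :: 'v::finite \<Rightarrow>\<^sub>0 nat. monom_degree t \<le> n} = (n + CARD('v)) choose CARD('v)"
  using card_monoms_supported[of "UNIV :: 'v set" n] by simp

section \<open>Monomial ideals, given by their exponents as \<open>upset A\<close>, and Dickson's
  lemma\<close>

definition upset :: "('v \<Rightarrow>\<^sub>0 nat) set \<Rightarrow> ('v \<Rightarrow>\<^sub>0 nat) set" where
  "upset A = {s + t | s t. s \<in> A}"

lemma upsetI: "s \<in> A \<Longrightarrow> s + t = u \<Longrightarrow> u \<in> upset A"
  unfolding upset_def by blast

lemma upset_empty [simp]: "upset {} = {}"
  unfolding upset_def by blast

lemma upset_insert: "upset (insert s A) = range ((+) s) \<union> upset A"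
  unfolding upset_def by blast

text \<open>Subsequences are taken for one coordinate after the other; monotonicity in the earlier
  coordinates survives.\<close>

lemma monotone_subseq:
  fixes f :: "nat \<Rightarrow> 'v \<Rightarrow> nat"
  assumes "finite A"
  shows "\<exists>r. strict_mono r \<and> (\<forall>x\<in>A. incseq (\<lambda>n. f (r n) x))"
  using assms
proof (induction A rule: finite_induct)
  case empty
  then show ?case using strict_mono_id by auto
next
  case (insert x A)
  then obtain r where r: "strict_mono r" "\<And>y. y \<in> A \<Longrightarrow> incseq (\<lambda>n. f (r n) y)" by blast
  obtain g :: "nat \<Rightarrow> nat" where g: "strict_mono g" "incseq (\<lambda>n. f (r (g n)) x)"
  proof -
    define h where "h = (\<lambda>n. f (r n) x)"
    obtain g where g: "strict_mono g" "monoseq (\<lambda>n. h (g n))" using seq_monosub by blast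
    show ?thesis
    proof (cases "incseq (\<lambda>n. h (g n))")
      case True
      then show ?thesis using that g h_def by blast
    next
      case False
      then have dec: "decseq (\<lambda>n. h (g n))" using g(2) by (auto simp: monoseq_iff)
      \<comment> \<open>A decreasing sequence of natural numbers is constant once it attains its
        minimum, so a tail of it is increasing.\<close>
      define m where "m = (LEAST k. \<exists>n. h (g n) = k)"
      have "\<exists>n. h (g n) = m" unfolding m_def by (rule LeastI_ex) blast
      then obtain n where n: "h (g n) = m" by blast
      have "h (g (n + k)) = m" for k
      proof (rule antisym)
        show "h (g (n + k)) \<le> m" using dec n by (metis decseqD le_add1)
        show "m \<le> h (g (n + k))" unfolding m_def by (rule Least_le) blast
      qed
      then have "incseq (\<lambda>k. h (g (n + k)))" by (simp add: incseq_def)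
      moreover have "strict_mono (\<lambda>k. g (n + k))" using g(1) by (simp add: strict_mono_def)
      ultimately show ?thesis using that h_def by blast
    qed
  qed
  have "strict_mono (r \<circ> g)" using r g by (simp add: strict_mono_o)
  moreover have "incseq (\<lambda>n. f ((r \<circ> g) n) y)" if "y \<in> insert x A" for y
    using that g r(2)[of y] by (auto simp: incseq_def strict_mono_less_eq)
  ultimately show ?case by blast
qed

text \<open>The generators are the elements of \<open>U\<close> minimal under divisibility. If there
  were infinitely many, a coordinatewise increasing subsequence would give two distinct ones, one
  dividing the other.\<close>

lemma dickson:
  fixes U :: "('v::finite \<Rightarrow>\<^sub>0 nat) set"
  assumes up: "\<And>s t. s \<in> U \<Longrightarrow> s + t \<in> U"
  obtains A where "finite A" "U = upset A"
proof -
  define A where "A = {t \<in> U. \<forall>s\<in>U. (\<forall>x. Poly_Mapping.lookup s x \<le> Poly_Mapping.lookup t x) \<longrightarrow> s = t}"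
  have "finite A"
  proof (rule ccontr)
    assume "infinite A"
    then obtain f :: "nat \<Rightarrow> _" where f: "inj f" "range f \<subseteq> A"
      using infinite_countable_subset by blast
    obtain r where r: "strict_mono r" "\<And>x. incseq (\<lambda>n. Poly_Mapping.lookup (f (r n)) x)"
      using monotone_subseq[of UNIV "\<lambda>n. Poly_Mapping.lookup (f n)"] by auto
    have "f (r 0) = f (r 1)"
      using f(2) incseqD[OF r(2), of 0 1] unfolding A_def by blast
    then have "r 0 = r 1" using f(1) by (simp add: inj_eq)
    then show False using r(1) by (metis strict_mono_eq zero_neq_one)
  qed
  moreover have "U = upset A"
  proof (intro equalityI subsetI)
    fix t assume "t \<in> U"
    then show "t \<in> upset A"
    proof (induction "monom_degree t" arbitrary: t rule: less_induct)
      case less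
      show ?case
      proof (cases "t \<in> A")
        case True
        then show ?thesis unfolding upset_def by force
      next
        case False
        then obtain s where s: "s \<in> U" "\<And>x. Poly_Mapping.lookup s x \<le> Poly_Mapping.lookup t x" "s \<noteq> t"
          using less.prems unfolding A_def by blast
        have eq: "s + (t - s) = t" using add_minus_monom[OF s(2)] .
        then have "monom_degree (t - s) \<noteq> 0" using s(3) by (auto simp: monom_degree_eq_0_iff)
        then have "monom_degree s < monom_degree t"
          using eq monom_degree_add[of s "t - s"] by simp
        then have "s \<in> upset A" using less.hyps s(1) by blast
        then obtain u w where "u \<in> A" "s = u + w" unfolding upset_def by blast
        then show ?thesis using eq by (intro upsetI[of u _ "w + (t - s)"]) (simp_all add: add.assoc)
      qed
    qed
  next
    fix t assume "t \<in> upset A"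
    then show "t \<in> U" unfolding upset_def A_def using up by auto
  qed
  ultimately show ?thesis using that by blast
qed

section \<open>Cumulative Hilbert functions of quotients by monomial ideals\<close>

definition cocount :: "('v::finite \<Rightarrow>\<^sub>0 nat) set \<Rightarrow> nat \<Rightarrow> nat" where
  "cocount U n = card {t. monom_degree t \<le> n \<and> t \<notin> U}"

lemma finite_cocount: "finite {t :: 'v::finite \<Rightarrow>\<^sub>0 nat. monom_degree t \<le> n \<and> t \<notin> U}"
  by (rule finite_subset[OF _ finite_monom_degree_le[of n]]) auto

lemma cocount_mono: "U \<subseteq> U' \<Longrightarrow> cocount U' n \<le> cocount U n"
  unfolding cocount_def by (intro card_mono finite_cocount) auto

lemma cocount_empty: "cocount ({} :: ('v::finite \<Rightarrow>\<^sub>0 nat) set) n = (n + CARD('v)) choose CARD('v)"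
  unfolding cocount_def using card_monoms by simp

text \<open>Let \<open>I\<close> be the monomial ideal of \<open>A\<close>. Multiplication by
  \<open>s\<close> identifies the monomials outside \<open>(I : s)\<close> with the multiples of
  \<open>s\<close> outside \<open>I\<close>. Truncated subtraction makes \<open>u - s\<close> the
  exponent of \<open>u / gcd(u, s)\<close>, and these quotients generate
  \<open>(I : s)\<close>.\<close>

lemma cocount_upset_insert:
  assumes "n \<ge> monom_degree s"
  shows "cocount (upset (insert s A)) n + cocount (upset ((\<lambda>t. t - s) ` A)) (n - monom_degree s)
    = cocount (upset A) n"
proof -
  have iff: "s + t \<in> upset A \<longleftrightarrow> t \<in> upset ((\<lambda>u. u - s) ` A)" for t
  proof
    assume "s + t \<in> upset A"
    then obtain u w where u: "u \<in> A" "s + t = u + w" unfolding upset_def by blast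
    have "Poly_Mapping.lookup (u - s) x \<le> Poly_Mapping.lookup t x" for x
      using arg_cong[OF u(2), of "\<lambda>m. Poly_Mapping.lookup m x"] by (simp add: lookup_add lookup_minus)
    then show "t \<in> upset ((\<lambda>u. u - s) ` A)"
      using add_minus_monom[of "u - s" t] u(1) by (intro upsetI[of "u - s"]) auto
  next
    assume "t \<in> upset ((\<lambda>u. u - s) ` A)"
    then obtain u w where u: "u \<in> A" "t = (u - s) + w" unfolding upset_def by blast
    have "Poly_Mapping.lookup u x \<le> Poly_Mapping.lookup (s + t) x" for x
      by (simp add: u(2) lookup_add lookup_minus)
    then show "s + t \<in> upset A"
      using add_minus_monom[of u "s + t"] u(1) by (intro upsetI[of u]) auto
  qed
  define X where "X = {t. monom_degree t \<le> n \<and> t \<notin> upset (insert s A)}"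
  define Y where "Y = {t. monom_degree t \<le> n - monom_degree s \<and> t \<notin> upset ((\<lambda>t. t - s) ` A)}"
  have "{t. monom_degree t \<le> n \<and> t \<notin> upset A} = X \<union> (+) s ` Y"
    unfolding X_def Y_def upset_insert using assms by (auto simp: iff monom_degree_add)
  moreover have "X \<inter> (+) s ` Y = {}"
    unfolding X_def upset_insert by auto
  ultimately have "card {t. monom_degree t \<le> n \<and> t \<notin> upset A} = card X + card ((+) s ` Y)"
    by (simp add: card_Un_disjoint X_def Y_def finite_cocount)
  then show ?thesis unfolding cocount_def X_def Y_def by (simp add: card_image)
qed

text \<open>Removing a generator \<open>s\<close> leaves two ideals with fewer generators, the
  remaining one and its quotient by \<open>s\<close>. The induction is strong because
  \<open>t - s\<close> may identify generators.\<close>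

lemma cocount_upset_hpoly:
  fixes A :: "('v::finite \<Rightarrow>\<^sub>0 nat) set"
  assumes "finite A"
  shows "\<exists>e. \<forall>\<^sub>F n in sequentially. int (cocount (upset A) n) = hpoly CARD('v) e n"
  using assms
proof (induction "card A" arbitrary: A rule: less_induct)
  case less
  show ?case
  proof (cases "A = {}")
    case True
    then have "\<forall>\<^sub>F n in sequentially. int (cocount (upset A) n) = hpoly CARD('v) (\<lambda>i. if i = 0 then 1 else 0) n"
      by (simp add: cocount_empty upset_def hpoly_binomial)
    then show ?thesis by blast
  next
    case False
    then obtain s A' where A: "A = insert s A'" "s \<notin> A'" by (meson Set.set_insert all_not_in_conv)
    then have fin: "finite A'" and lt: "card A' < card A" using less.prems by auto
    let ?B = "(\<lambda>t. t - s) ` A'"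
    have "card ?B < card A" using lt card_image_le[OF fin] le_less_trans by blast
    then obtain e1 where e1: "\<forall>\<^sub>F n in sequentially. int (cocount (upset ?B) n) = hpoly CARD('v) e1 n"
      using less.hyps fin by blast
    obtain e2 where e2: "\<forall>\<^sub>F n in sequentially. int (cocount (upset A') n) = hpoly CARD('v) e2 n"
      using less.hyps[OF lt fin] by blast
    obtain e3 where e3: "\<forall>\<^sub>F n in sequentially. int (cocount (upset ?B) (n - monom_degree s)) = hpoly CARD('v) e3 n"
      using eventually_hpoly_shift[OF e1] by blast
    have "\<forall>\<^sub>F n in sequentially. int (cocount (upset A) n) = hpoly CARD('v) (\<lambda>i. e2 i - e3 i) n"
      using e2 e3 eventually_ge_at_top[of "monom_degree s"]
    proof eventually_elim
      case (elim n)
      then show ?case using cocount_upset_insert[OF elim(3), of A'] by (simp add: hpoly_diff A(1))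
    qed
    then show ?thesis by blast
  qed
qed

text \<open>A principal ideal: all monomials minus the multiples of \<open>s\<close>, that is, a
  binomial coefficient minus its shift by the degree of \<open>s\<close>.\<close>

lemma cocount_upset_singleton:
  fixes s :: "'v::finite \<Rightarrow>\<^sub>0 nat"
  obtains e where "e 0 = 0" "e 1 = - int (monom_degree s)"
    "\<forall>\<^sub>F n in sequentially. int (cocount (upset {s}) n) = hpoly CARD('v) e n"
proof -
  let ?f = "\<lambda>n. int (cocount ({} :: ('v \<Rightarrow>\<^sub>0 nat) set) n)"
  let ?e = "\<lambda>i::nat. if i = 0 then 1 else (0::int)"
  have f: "?f n = hpoly CARD('v) ?e n" for n
    by (simp add: cocount_empty hpoly_binomial)
  then have "\<forall>\<^sub>F n in sequentially. ?f n = hpoly CARD('v) ?e n" by simp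
  then obtain e' where e': "e' 0 = ?e 0" "e' 1 = ?e 1 + int (monom_degree s) * ?e 0"
    "\<forall>\<^sub>F n in sequentially. ?f (n - monom_degree s) = hpoly CARD('v) e' n"
    by (rule eventually_hpoly_shift)
  have "\<forall>\<^sub>F n in sequentially. int (cocount (upset {s}) n) = hpoly CARD('v) (\<lambda>i. ?e i - e' i) n"
    using e'(3) eventually_ge_at_top[of "monom_degree s"]
  proof eventually_elim
    case (elim n)
    have "cocount (upset {s}) n + cocount ({} :: ('v \<Rightarrow>\<^sub>0 nat) set) (n - monom_degree s) = cocount ({} :: ('v \<Rightarrow>\<^sub>0 nat) set) n"
      using cocount_upset_insert[OF elim(2), of "{}"] by simp
    then show ?case using elim(1) f[of n] by (simp add: hpoly_diff)
  qed
  with e'(1,2) that[of "\<lambda>i. ?e i - e' i"] show ?thesis by simp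
qed

text \<open>Comparison with principal ideals. One contained in \<open>U\<close> forces
  \<open>e 0 = 0\<close>; if a variable divided every monomial of \<open>U\<close>, then
  \<open>U\<close> would lie in the ideal of that variable, whose coefficient \<open>e 1\<close> is
  -1.\<close>

lemma cocount_hpoly:
  fixes U :: "('v::finite \<Rightarrow>\<^sub>0 nat) set"
  assumes up: "\<And>s t. s \<in> U \<Longrightarrow> s + t \<in> U" and "s \<in> U"
  obtains e where "\<forall>\<^sub>F n in sequentially. int (cocount U n) = hpoly CARD('v) e n"
    "e 0 = 0" "e 1 \<le> 0" "e 1 = 0 \<longrightarrow> (\<forall>x. \<exists>t\<in>U. Poly_Mapping.lookup t x = 0)"
proof -
  obtain A where "finite A" "U = upset A" using dickson[OF up] by blast
  then obtain e where e: "\<forall>\<^sub>F n in sequentially. int (cocount U n) = hpoly CARD('v) e n"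
    using cocount_upset_hpoly by blast
  obtain d where d: "CARD('v) = Suc d" using not0_implies_Suc[of "CARD('v)"] by auto
  have "upset {s} \<subseteq> U" using up \<open>s \<in> U\<close> unfolding upset_def by auto
  obtain e' where e': "e' 0 = 0"
    "\<forall>\<^sub>F n in sequentially. int (cocount (upset {s}) n) = hpoly CARD('v) e' n"
    using cocount_upset_singleton by blast
  have "\<forall>\<^sub>F n in sequentially. hpoly CARD('v) (\<lambda>i. e' i - e i) n \<ge> 0"
    using e e'(2)
  proof eventually_elim
    case (elim n)
    then show ?case using cocount_mono[OF \<open>upset {s} \<subseteq> U\<close>, of n] by (simp add: hpoly_diff)
  qed
  then have "e 0 \<le> 0" using hpoly_nonneg_lead e'(1) by fastforce
  have nonneg: "\<forall>\<^sub>F n in sequentially. hpoly CARD('v) e n \<ge> 0"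
    using e by eventually_elim simp
  then have "e 0 \<ge> 0" using hpoly_nonneg_lead by blast
  with \<open>e 0 \<le> 0\<close> have e0: "e 0 = 0" by simp
  \<comment> \<open>Once the leading coefficient vanishes, minus the next one becomes the leading
    coefficient for one variable fewer.\<close>
  have drop: "hpoly CARD('v) f n = hpoly d (\<lambda>i. - f (Suc i)) n" if "f 0 = 0" for f n
    by (simp add: d hpoly_Suc hpoly_uminus that)
  have "\<forall>\<^sub>F n in sequentially. hpoly d (\<lambda>i. - e (Suc i)) n \<ge> 0"
    using nonneg using drop[of e, OF e0] by simp
  then have e1: "e 1 \<le> 0" using hpoly_nonneg_lead by fastforce
  have "\<exists>t\<in>U. Poly_Mapping.lookup t x = 0" if "e 1 = 0" for x
  proof (rule ccontr)
    assume neg: "\<not> (\<exists>t\<in>U. Poly_Mapping.lookup t x = 0)"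
    let ?x = "Poly_Mapping.single x (1::nat)"
    have "U \<subseteq> upset {?x}"
    proof
      fix t assume "t \<in> U"
      then have "?x + (t - ?x) = t"
        using neg by (intro add_minus_monom) (auto simp: lookup_single when_def Suc_le_eq)
      then show "t \<in> upset {?x}" by (intro upsetI[of ?x]) auto
    qed
    obtain f where f: "f 0 = 0" "f 1 = - int (monom_degree ?x)"
      "\<forall>\<^sub>F n in sequentially. int (cocount (upset {?x}) n) = hpoly CARD('v) f n"
      using cocount_upset_singleton by blast
    have "\<forall>\<^sub>F n in sequentially. hpoly CARD('v) (\<lambda>i. e i - f i) n \<ge> 0"
      using e f(3)
    proof eventually_elim
      case (elim n)
      then show ?case using cocount_mono[OF \<open>U \<subseteq> upset {?x}\<close>, of n] by (simp add: hpoly_diff)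
    qed
    then have "\<forall>\<^sub>F n in sequentially. hpoly d (\<lambda>i. - (e (Suc i) - f (Suc i))) n \<ge> 0"
      using drop[of "\<lambda>i. e i - f i"] e0 f(1) by simp
    \<comment> \<open>The new leading coefficient is \<open>f 1 - e 1 = -1\<close>, which is
      negative.\<close>
    from hpoly_nonneg_lead[OF this] show False using that f(2) by simp
  qed
  with e e0 e1 that show ?thesis by blast
qed

section \<open>Leading monomials\<close>

text \<open>
  Distinct primes as weights turn monomials injectively and multiplicatively into natural numbers;
  comparing weights is a monomial order that needs no order on the variables.
\<close>

definition var_prime :: "'v::finite \<Rightarrow> nat" where
  "var_prime = (SOME f. inj f \<and> (\<forall>x. prime (f x)))"

lemma var_prime: "inj (var_prime :: 'v::finite \<Rightarrow> nat)" "prime (var_prime (x :: 'v))"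
proof -
  obtain f :: "'v \<Rightarrow> nat" where "inj f"
    using finite_imp_inj_to_nat_seg[of "UNIV :: 'v set"] by auto
  have inf: "infinite {p :: nat. prime p}" by (rule primes_infinite)
  define g where "g = enumerate {p :: nat. prime p} \<circ> f"
  have "inj g \<and> (\<forall>x. prime (g x))"
    unfolding g_def using \<open>inj f\<close> enumerate_in_set[OF inf] strict_mono_enumerate[OF inf]
    by (simp add: inj_compose strict_mono_imp_inj_on)
  then have "inj (var_prime :: 'v \<Rightarrow> nat) \<and> (\<forall>x :: 'v. prime (var_prime x))"
    unfolding var_prime_def by (rule someI[of "\<lambda>f. inj f \<and> (\<forall>x. prime (f x))"])
  then show "inj (var_prime :: 'v::finite \<Rightarrow> nat)" "prime (var_prime x)" by auto
qed

definition weight :: "('v::finite \<Rightarrow>\<^sub>0 nat) \<Rightarrow> nat" where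
  "weight t = (\<Prod>x\<in>UNIV. var_prime x ^ Poly_Mapping.lookup t x)"

lemma weight_add: "weight (s + t) = weight s * weight t"
  by (simp add: weight_def lookup_add power_add prod.distrib)

lemma weight_pos [simp]: "weight t > 0"
  unfolding weight_def by (intro prod_pos ballI zero_less_power prime_gt_0_nat var_prime(2))

lemma weight_inj: "weight s = weight t \<longleftrightarrow> s = (t :: 'v::finite \<Rightarrow>\<^sub>0 nat)"
proof
  assume eq: "weight s = weight t"
  have "multiplicity (var_prime x) (weight t) = Poly_Mapping.lookup t x" for x :: 'v and t
  proof -
    define g where "g = Poly_Mapping.lookup t \<circ> inv var_prime"
    have "weight t = (\<Prod>p\<in>range (var_prime :: 'v \<Rightarrow> nat). p ^ g p)"
      unfolding weight_def g_def by (subst prod.reindex) (auto simp: var_prime(1))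
    also have "multiplicity (var_prime x) \<dots> = g (var_prime x)"
      using var_prime(2) by (subst multiplicity_prod_prime_powers) auto
    finally show ?thesis by (simp add: g_def var_prime(1))
  qed
  with eq show "s = t" by (metis poly_mapping_eqI)
qed simp

definition lead :: "(('v::finite \<Rightarrow>\<^sub>0 nat) \<Rightarrow>\<^sub>0 'k::zero) \<Rightarrow> ('v \<Rightarrow>\<^sub>0 nat)" where
  "lead p = arg_max_on weight (Poly_Mapping.keys p)"

lemma lead_in_keys: "p \<noteq> 0 \<Longrightarrow> lead p \<in> Poly_Mapping.keys p"
  and lead_max: "s \<in> Poly_Mapping.keys p \<Longrightarrow> weight s \<le> weight (lead p)"
proof -
  have *: "lead p \<in> Poly_Mapping.keys p \<and> (\<forall>s\<in>Poly_Mapping.keys p. weight s \<le> weight (lead p))" if "p \<noteq> 0"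
  proof -
    have "\<exists>t\<in>Poly_Mapping.keys p. \<forall>s\<in>Poly_Mapping.keys p. weight s \<le> weight t"
    proof -
      have "Max (weight ` Poly_Mapping.keys p) \<in> weight ` Poly_Mapping.keys p"
        using that by (intro Max_in) (auto simp: keys_eq_empty)
      then obtain t where "t \<in> Poly_Mapping.keys p" "weight t = Max (weight ` Poly_Mapping.keys p)" by auto
      then show ?thesis by (intro bexI[of _ t]) auto
    qed
    then have "\<exists>t. is_arg_max weight (\<lambda>t. t \<in> Poly_Mapping.keys p) t"
      by (auto simp: is_arg_max_linorder)
    then have "is_arg_max weight (\<lambda>t. t \<in> Poly_Mapping.keys p) (lead p)"
      unfolding lead_def arg_max_on_def arg_max_def by (rule someI_ex)
    then show ?thesis by (auto simp: is_arg_max_linorder)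
  qed
  show "p \<noteq> 0 \<Longrightarrow> lead p \<in> Poly_Mapping.keys p" using * by blast
  show "s \<in> Poly_Mapping.keys p \<Longrightarrow> weight s \<le> weight (lead p)" using * by (cases "p = 0") auto
qed

lemma lead_eqI:
  assumes "t \<in> Poly_Mapping.keys p" "\<And>s. s \<in> Poly_Mapping.keys p \<Longrightarrow> weight s \<le> weight t"
  shows "lead p = t"
proof -
  have "p \<noteq> 0" using assms(1) by auto
  then have "weight (lead p) = weight t"
    by (intro antisym assms lead_in_keys lead_max)
  then show ?thesis by (simp add: weight_inj)
qed

text \<open>Weights are multiplicative, so the two leading exponents are the only pair from the
  supports with their sum. Nothing can cancel there, and the polynomial ring has no zero
  divisors.\<close>

lemma lead_mult:
  fixes p q :: "('v::finite, 'k::field) mpoly"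
  assumes "p \<noteq> 0" "q \<noteq> 0"
  shows "p * q \<noteq> 0" "lead (p * q) = lead p + lead q"
    "Poly_Mapping.lookup (p * q) (lead p + lead q) =
      Poly_Mapping.lookup p (lead p) * Poly_Mapping.lookup q (lead q)"
proof -
  have uniq: "l = lead p \<and> r = lead q"
    if "l \<in> Poly_Mapping.keys p" "r \<in> Poly_Mapping.keys q" "lead p + lead q = l + r" for l r
  proof -
    have "weight l \<le> weight (lead p)" "weight r \<le> weight (lead q)" using that lead_max by auto
    moreover have "weight (lead p) * weight (lead q) = weight l * weight r"
      using that(3) by (metis weight_add)
    ultimately have "weight l = weight (lead p)"
      by (metis le_neq_implies_less less_irrefl mult_less_le_imp_less weight_pos zero_le)
    then show ?thesis using that(3) by (simp add: weight_inj)
  qed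
  have "Poly_Mapping.lookup (p * q) (lead p + lead q) =
      (\<Sum>l. Poly_Mapping.lookup p l * (\<Sum>r. Poly_Mapping.lookup q r when lead p + lead q = l + r))"
    by (rule lookup_mult)
  also have "\<dots> = (\<Sum>l. (Poly_Mapping.lookup p (lead p) * Poly_Mapping.lookup q (lead q)) when l = lead p)"
  proof (intro Sum_any.cong)
    fix l
    show "Poly_Mapping.lookup p l * (\<Sum>r. Poly_Mapping.lookup q r when lead p + lead q = l + r)
      = (Poly_Mapping.lookup p (lead p) * Poly_Mapping.lookup q (lead q) when l = lead p)"
    proof (cases "l = lead p")
      case True
      then show ?thesis by simp
    next
      case False
      have "Poly_Mapping.lookup p l * (Poly_Mapping.lookup q r when lead p + lead q = l + r) = 0" for r
        using uniq[of l r] False by (cases "l \<in> Poly_Mapping.keys p"; cases "r \<in> Poly_Mapping.keys q")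
          (auto simp: in_keys_iff when_def)
      then have "Poly_Mapping.lookup p l = 0 \<or> (\<forall>r. (Poly_Mapping.lookup q r when lead p + lead q = l + r) = 0)"
        by (metis mult_eq_0_iff)
      then show ?thesis using False by auto
    qed
  qed
  also have "\<dots> = Poly_Mapping.lookup p (lead p) * Poly_Mapping.lookup q (lead q)" by simp
  finally show *: "Poly_Mapping.lookup (p * q) (lead p + lead q) =
      Poly_Mapping.lookup p (lead p) * Poly_Mapping.lookup q (lead q)" .
  then have key: "lead p + lead q \<in> Poly_Mapping.keys (p * q)"
    using lead_in_keys[OF assms(1)] lead_in_keys[OF assms(2)] by (simp add: in_keys_iff)
  then show "p * q \<noteq> 0" by auto
  show "lead (p * q) = lead p + lead q"
    using key
  proof (rule lead_eqI)
    fix s assume "s \<in> Poly_Mapping.keys (p * q)"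
    then obtain a b where "s = a + b" "a \<in> Poly_Mapping.keys p" "b \<in> Poly_Mapping.keys q"
      using keys_mult by fast
    then show "weight s \<le> weight (lead p + lead q)"
      by (auto simp: weight_add intro!: mult_le_mono lead_max)
  qed
qed

text \<open>
  Comparing leading monomials in \<open>q * u = p * w\<close> for all the given \<open>q\<close> shows that the leading monomial
  of \<open>p\<close> divides that of \<open>u\<close>, so long division of \<open>u\<close> by \<open>p\<close> never gets stuck. This replaces a
  gcd argument in the ring of polynomials, which is factorial.
\<close>

lemma poly_dvd_if_cofactors_dvd:
  fixes p u :: "('v::finite, 'k::field) mpoly"
  assumes "p \<noteq> 0" and "\<And>x. \<exists>q. q \<noteq> 0 \<and> Poly_Mapping.lookup (lead q) x = 0 \<and> p dvd q * u"
  shows "p dvd u"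
  using assms(2)
proof (induction "weight (lead u)" arbitrary: u rule: less_induct)
  case less
  show ?case
  proof (cases "u = 0")
    case True
    then show ?thesis by simp
  next
    case u: False
    have le: "Poly_Mapping.lookup (lead p) x \<le> Poly_Mapping.lookup (lead u) x" for x
    proof -
      obtain q w where q: "q \<noteq> 0" "Poly_Mapping.lookup (lead q) x = 0" "q * u = p * w"
        using less.prems[of x] by (auto elim: dvdE)
      have "w \<noteq> 0" using q u lead_mult(1) by fastforce
      then have "lead q + lead u = lead p + lead w"
        using q u assms(1) by (metis lead_mult(2))
      then have "Poly_Mapping.lookup (lead q + lead u) x = Poly_Mapping.lookup (lead p + lead w) x"
        by simp
      then show ?thesis using q(2) by (simp add: lookup_add)
    qed
    define c where "c = Poly_Mapping.lookup u (lead u) / Poly_Mapping.lookup p (lead p)"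
    define m where "m = Poly_Mapping.single (lead u - lead p) c"
    have c: "c \<noteq> 0" unfolding c_def using lead_in_keys u assms(1) by (auto simp: in_keys_iff)
    have m: "m \<noteq> 0" unfolding m_def using c by (metis lookup_single_eq lookup_zero)
    have lm: "lead m = lead u - lead p" unfolding m_def by (rule lead_eqI) (auto simp: c)
    define u' where "u' = u - p * m"
    have lpm: "lead (p * m) = lead u"
      using lead_mult(2)[OF assms(1) m] add_minus_monom[OF le] lm by simp
    have lk: "Poly_Mapping.lookup (p * m) (lead u) = Poly_Mapping.lookup u (lead u)"
      using lead_mult(3)[OF assms(1) m] add_minus_monom[OF le] lm lead_in_keys[OF assms(1)]
      by (simp add: m_def c_def in_keys_iff)
    have "p dvd u'"
    proof (cases "u' = 0")
      case False
      have "lead u' \<in> Poly_Mapping.keys u \<union> Poly_Mapping.keys (p * m)"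
        using lead_in_keys[OF False] unfolding u'_def by (auto simp: in_keys_iff lookup_minus)
      then have "weight (lead u') \<le> weight (lead u)" using lead_max lpm by (metis Un_iff)
      moreover have "lead u' \<noteq> lead u"
        using lead_in_keys[OF False] lk unfolding u'_def by (auto simp: in_keys_iff lookup_minus)
      ultimately have "weight (lead u') < weight (lead u)" by (simp add: weight_inj order_less_le)
      \<comment> \<open>The cofactors for \<open>u\<close> also serve for \<open>u'\<close>, since
        the two differ by a multiple of \<open>p\<close>.\<close>
      moreover have "\<exists>q. q \<noteq> 0 \<and> Poly_Mapping.lookup (lead q) x = 0 \<and> p dvd q * u'" for x
      proof -
        obtain q where q: "q \<noteq> 0" "Poly_Mapping.lookup (lead q) x = 0" "p dvd q * u"
          using less.prems by blast
        have "q * u' = q * u - p * (q * m)" by (simp add: u'_def algebra_simps)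
        then have "p dvd q * u'" using q(3) by (simp add: dvd_diff)
        with q show ?thesis by blast
      qed
      ultimately show ?thesis using less.hyps by blast
    qed simp
    then have "p dvd u' + p * m" by simp
    then show ?thesis by (simp add: u'_def)
  qed
qed

section \<open>Homogeneous components\<close>

definition hcomp :: "nat \<Rightarrow> ('v::finite, 'k::comm_monoid_add) mpoly \<Rightarrow> ('v, 'k) mpoly" where
  "hcomp i p = (\<Sum>t | t \<in> Poly_Mapping.keys p \<and> monom_degree t = i. Poly_Mapping.single t (Poly_Mapping.lookup p t))"

lemma lookup_hcomp: "Poly_Mapping.lookup (hcomp i p) t = (if monom_degree t = i then Poly_Mapping.lookup p t else 0)"
proof -
  have "Poly_Mapping.lookup (hcomp i p) t =
      (\<Sum>s | s \<in> Poly_Mapping.keys p \<and> monom_degree s = i. if s = t then Poly_Mapping.lookup p s else 0)"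
    unfolding hcomp_def lookup_sum by (intro sum.cong) (auto simp: lookup_single when_def)
  then show ?thesis by (simp add: sum.delta in_keys_iff)
qed

lemma hcomp_homogeneous: "hcomp i p \<in> homogeneous_polys i"
  unfolding homogeneous_polys_def by (auto simp: in_keys_iff lookup_hcomp split: if_splits)

lemma hcomp_0: "hcomp 0 p = Poly_Mapping.single 0 (Poly_Mapping.lookup p 0)"
  by (intro poly_mapping_eqI) (auto simp: lookup_hcomp lookup_single when_def monom_degree_eq_0_iff)

lemma sum_hcomp:
  assumes "finite K" "monom_degree ` Poly_Mapping.keys p \<subseteq> K"
  shows "(\<Sum>i\<in>K. hcomp i p) = p"
proof (rule poly_mapping_eqI)
  fix t
  have "Poly_Mapping.lookup (\<Sum>i\<in>K. hcomp i p) t = (\<Sum>i\<in>K. if monom_degree t = i then Poly_Mapping.lookup p t else 0)"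
    by (simp add: lookup_sum lookup_hcomp)
  also have "\<dots> = Poly_Mapping.lookup p t"
    using assms by (auto simp: in_keys_iff sum.delta' image_subset_iff)
  finally show "Poly_Mapping.lookup (\<Sum>i\<in>K. hcomp i p) t = Poly_Mapping.lookup p t" .
qed

lemma poly_eq_sum_monoms: "p = (\<Sum>t\<in>Poly_Mapping.keys p. Poly_Mapping.single t (Poly_Mapping.lookup p t))"
proof (rule poly_mapping_eqI)
  fix t
  have "Poly_Mapping.lookup (\<Sum>s\<in>Poly_Mapping.keys p. Poly_Mapping.single s (Poly_Mapping.lookup p s)) t
      = (\<Sum>s\<in>Poly_Mapping.keys p. if s = t then Poly_Mapping.lookup p s else 0)"
    unfolding lookup_sum by (intro sum.cong) (auto simp: lookup_single when_def)
  then show "Poly_Mapping.lookup p t = Poly_Mapping.lookup (\<Sum>s\<in>Poly_Mapping.keys p. Poly_Mapping.single s (Poly_Mapping.lookup p s)) t"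
    by (simp add: sum.delta in_keys_iff)
qed

section \<open>Dimensions of finitely spanned subspaces\<close>

context vector_space
begin

lemma dim_insert_finite:
  assumes "finite S"
  shows "dim (insert x S) = (if x \<in> span S then dim S else Suc (dim S))"
proof (cases "x \<in> span S")
  case True
  then show ?thesis by (metis dim_span span_redundant)
next
  case False
  obtain B where B: "B \<subseteq> S" "independent B" "S \<subseteq> span B"
    using maximal_independent_subset by blast
  have span: "span B = span S" using B by (metis span_mono span_span subset_antisym)
  have fin: "finite B" using B(1) assms finite_subset by blast
  have "x \<notin> span B" using False span by simp
  then have "independent (insert x B)" "x \<notin> B"
    using independent_insertI[OF _ B(2)] span_base by blast+
  moreover have "span (insert x B) = span (insert x S)"
    using span by (simp add: span_insert)
  ultimately have "dim (insert x S) = Suc (card B)"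
    using dim_eq_card[of "insert x B" "insert x S"] fin by simp
  moreover have "dim S = card B" using dim_eq_card[OF span B(2)] .
  ultimately show ?thesis using False by simp
qed

text \<open>The vectors \<open>v t\<close> are added in increasing order of \<open>w t\<close>; each
  raises the dimension by one unless the earlier ones already span it.\<close>

lemma dim_Un_image:
  fixes w :: "'i \<Rightarrow> nat"
  assumes "finite S" "finite T" "inj_on w T"
  shows "dim (S \<union> v ` T) = dim S + card {t \<in> T. v t \<notin> span (S \<union> v ` {s \<in> T. w s < w t})}"
  using assms(2,3)
proof (induction T rule: finite_ranking_induct[where f = w])
  case empty
  then show ?case by simp
next
  case (insert x T)
  show ?case
  proof (cases "x \<in> T")
    case True
    then show ?thesis using insert by (simp add: insert_absorb)
  next
    case False
    \<comment> \<open>Injectivity of \<open>w\<close> makes the new index strictly largest, so the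
      conditions on the older indices do not change.\<close>
    have lt: "w t < w x" if "t \<in> T" for t
      using insert.hyps(2)[OF that] insert.prems that False
      by (metis inj_on_eq_iff insert_iff order_le_imp_less_or_eq)
    have 1: "{s. (s = x \<or> s \<in> T) \<and> w s < w t} = {s \<in> T. w s < w t}" if "t \<in> T" for t
      using lt[OF that] by auto
    have 2: "{s. (s = x \<or> s \<in> T) \<and> w s < w x} = T"
      using lt by auto
    define C where "C = {t \<in> T. v t \<notin> span (S \<union> v ` {s \<in> T. w s < w t})}"
    have "{t \<in> insert x T. v t \<notin> span (S \<union> v ` {s \<in> insert x T. w s < w t})}
      = (if v x \<in> span (S \<union> v ` T) then C else insert x C)"
      unfolding C_def by (auto simp: 1 2)
    moreover have "x \<notin> C" "finite C" unfolding C_def using False insert.hyps by auto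
    moreover have "dim (S \<union> v ` insert x T) =
        (if v x \<in> span (S \<union> v ` T) then dim (S \<union> v ` T) else Suc (dim (S \<union> v ` T)))"
      using dim_insert_finite[of "S \<union> v ` T" "v x"] assms(1) insert.hyps(1) by simp
    moreover have "dim (S \<union> v ` T) = dim S + card C"
      unfolding C_def using insert.IH insert.prems by (simp add: inj_on_insert)
    ultimately show ?thesis by simp
  qed
qed

end

section \<open>Graded modules\<close>

context graded_module
begin

abbreviation mono_scale :: "('v \<Rightarrow>\<^sub>0 nat) \<Rightarrow> 'm \<Rightarrow> 'm" where
  "mono_scale t \<equiv> scale (Poly_Mapping.single t 1)"

lemma scale_single: "scale (Poly_Mapping.single t c) m = scale (Poly_Mapping.single 0 c) (mono_scale t m)"
  by (simp add: mult_single)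

lemma mono_scale_add: "mono_scale (s + t) m = mono_scale s (mono_scale t m)"
  by (simp add: mult_single)

lemma base_subspace_Mg: "base.subspace (Mg j)"
proof (rule base.subspaceI)
  fix c :: 'k and x assume "x \<in> Mg j"
  moreover have "Poly_Mapping.single 0 c \<in> homogeneous_polys 0"
    by (simp add: homogeneous_polys_def)
  ultimately show "scale (Poly_Mapping.single 0 c) x \<in> Mg j"
    using graded_scale by force
qed (simp_all add: graded_zero graded_add)

lemma base_subspace_span: "base.subspace (span H)"
  by (rule base.subspaceI) (simp_all add: span_zero span_add span_scale)

lemma base_span_mono_scale:
  assumes "y \<in> base.span S"
  shows "mono_scale t y \<in> base.span (mono_scale t ` S)"
  using assms
proof (induction rule: base.span_induct_alt)
  case base
  then show ?case by (simp add: base.span_zero)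
next
  case (step c x y)
  have "mono_scale t (scale (Poly_Mapping.single 0 c) x + y) =
      scale (Poly_Mapping.single 0 c) (mono_scale t x) + mono_scale t y"
    by (simp add: scale_right_distrib mult_single)
  moreover have "\<dots> \<in> base.span (mono_scale t ` S)"
    by (intro base.span_add base.span_scale base.span_base imageI step)
  ultimately show ?case by simp
qed

text \<open>
  Uniqueness of homogeneous decompositions. For \<open>m = 0\<close> it splits every relation into homogeneous
  relations.
\<close>

lemma homogeneous_decomposition:
  assumes G: "finite G" "G \<subseteq> Mg a" and m: "m = (\<Sum>g\<in>G. scale (p g) g)" "m \<in> Mg z"
  shows "m = (if z < a then 0 else \<Sum>g\<in>G. scale (hcomp (nat (z - a)) (p g)) g)"
proof -
  define F where "F = (\<lambda>z. if z < a then 0 else \<Sum>g\<in>G. scale (hcomp (nat (z - a)) (p g)) g)"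
  \<comment> \<open>\<open>K\<close> holds every degree occurring in a coefficient, so summing
    \<open>F\<close> over these degrees, shifted by \<open>a\<close>, recovers
    \<open>m\<close>.\<close>
  define K where "K = (\<Union>g\<in>G. monom_degree ` Poly_Mapping.keys (p g))"
  have K: "finite K" unfolding K_def using G(1) by auto
  have inj: "inj_on (\<lambda>i. int i + a) K" by (simp add: inj_on_def)
  have FMg: "F z \<in> Mg z" for z
  proof (cases "z < a")
    case False
    have "scale (hcomp (nat (z - a)) (p g)) g \<in> Mg z" if "g \<in> G" for g
      using graded_scale[OF hcomp_homogeneous, of g a "nat (z - a)" "p g"] that G(2) False by auto
    then show ?thesis unfolding F_def using False
      by (auto intro: base.subspace_sum[OF base_subspace_Mg])
  qed (simp add: F_def graded_zero)
  have supp: "{z. F z \<noteq> 0} \<subseteq> (\<lambda>i. int i + a) ` K"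
  proof
    fix z assume "z \<in> {z. F z \<noteq> 0}"
    then have z: "\<not> z < a" "(\<Sum>g\<in>G. scale (hcomp (nat (z - a)) (p g)) g) \<noteq> 0"
      unfolding F_def by (auto split: if_splits)
    then obtain g where g: "g \<in> G" "scale (hcomp (nat (z - a)) (p g)) g \<noteq> 0"
      by (meson sum.not_neutral_contains_not_neutral)
    then have "hcomp (nat (z - a)) (p g) \<noteq> 0" by auto
    then obtain t where "Poly_Mapping.lookup (hcomp (nat (z - a)) (p g)) t \<noteq> 0"
      by (metis lookup_zero poly_mapping_eqI)
    then have "monom_degree t = nat (z - a)" "t \<in> Poly_Mapping.keys (p g)"
      by (auto simp: lookup_hcomp in_keys_iff split: if_splits)
    then have "nat (z - a) \<in> K" unfolding K_def using g(1) by (metis UN_I image_eqI)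
    then show "z \<in> (\<lambda>i. int i + a) ` K" using z(1) by (intro image_eqI[of _ _ "nat (z - a)"]) auto
  qed
  have "(\<Sum>z | F z \<noteq> 0. F z) = (\<Sum>z\<in>(\<lambda>i. int i + a) ` K. F z)"
    using supp K by (intro sum.mono_neutral_left) auto
  also have "\<dots> = (\<Sum>i\<in>K. \<Sum>g\<in>G. scale (hcomp i (p g)) g)"
    unfolding sum.reindex[OF inj] by (simp add: F_def)
  also have "\<dots> = (\<Sum>g\<in>G. scale (\<Sum>i\<in>K. hcomp i (p g)) g)"
    by (subst sum.swap) (simp add: scale_sum_left)
  also have "\<dots> = m"
    unfolding m(1)
  proof (intro sum.cong refl)
    fix g assume "g \<in> G"
    then have "(\<Sum>i\<in>K. hcomp i (p g)) = p g"
      by (intro sum_hcomp K) (auto simp: K_def)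
    then show "scale (\<Sum>i\<in>K. hcomp i (p g)) g = scale (p g) g" by simp
  qed
  finally have F: "(\<forall>j. F j \<in> Mg j) \<and> finite {j. F j \<noteq> 0} \<and> m = (\<Sum>j | F j \<noteq> 0. F j)"
    using FMg finite_subset[OF supp] K by auto
  \<comment> \<open>The second decomposition: \<open>m\<close> is homogeneous, so it is its own
    component in degree \<open>z\<close>.\<close>
  define E where "E = (\<lambda>j. if j = z then m else 0)"
  have "{j. E j \<noteq> 0} = (if m = 0 then {} else {z})" unfolding E_def by auto
  then have "(\<forall>j. E j \<in> Mg j) \<and> finite {j. E j \<noteq> 0} \<and> m = (\<Sum>j | E j \<noteq> 0. E j)"
    using m(2) graded_zero by (auto simp: E_def)
  then have "E = F" using direct_sum[of m] F by blast
  then have "E z = F z" by simp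
  then show ?thesis unfolding E_def F_def by simp
qed

lemma homogeneous_relation:
  assumes "finite G" "G \<subseteq> Mg a" "(\<Sum>g\<in>G. scale (p g) g) = 0"
  shows "(\<Sum>g\<in>G. scale (hcomp i (p g)) g) = 0"
  using homogeneous_decomposition[OF assms(1,2) assms(3)[symmetric] graded_zero, of "int i + a"]
  by simp

text \<open>For \<open>H\<close> inside \<open>Mg a\<close>, these elements span, over the ground
  field, the component of degree \<open>a + i\<close> of the submodule generated by
  \<open>H\<close>.\<close>

definition monomial_multiples :: "nat \<Rightarrow> 'm set \<Rightarrow> 'm set" where
  "monomial_multiples i H = (\<lambda>(t, h). mono_scale t h) ` ({t. monom_degree t = i} \<times> H)"

lemma finite_monomial_multiples: "finite H \<Longrightarrow> finite (monomial_multiples i H)"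
  unfolding monomial_multiples_def by (simp add: finite_monom_degree_eq)

lemma monomial_multiplesI: "monom_degree t = i \<Longrightarrow> h \<in> H \<Longrightarrow> mono_scale t h \<in> monomial_multiples i H"
  unfolding monomial_multiples_def by force

lemma monomial_multiplesE:
  assumes "x \<in> monomial_multiples i H"
  obtains t h where "x = mono_scale t h" "monom_degree t = i" "h \<in> H"
  using assms unfolding monomial_multiples_def by auto

lemma monomial_multiples_insert:
  "monomial_multiples i (insert g H) = monomial_multiples i H \<union> (\<lambda>t. mono_scale t g) ` {t. monom_degree t = i}"
  unfolding monomial_multiples_def by auto

lemma scale_in_span_monoms:
  assumes "\<And>t. t \<in> Poly_Mapping.keys p \<Longrightarrow> mono_scale t h \<in> S"
  shows "scale p h \<in> base.span S"
proof -
  have "scale p h = (\<Sum>t\<in>Poly_Mapping.keys p. scale (Poly_Mapping.single t (Poly_Mapping.lookup p t)) h)"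
    by (subst (1) poly_eq_sum_monoms) (rule scale_sum_left)
  also have "\<dots> = (\<Sum>t\<in>Poly_Mapping.keys p. scale (Poly_Mapping.single 0 (Poly_Mapping.lookup p t)) (mono_scale t h))"
    by (intro sum.cong refl scale_single)
  also have "\<dots> \<in> base.span S"
    by (intro base.span_sum base.span_scale base.span_base assms)
  finally show ?thesis .
qed

lemma homogeneous_scale_in_span:
  assumes "p \<in> homogeneous_polys i" "h \<in> H"
  shows "scale p h \<in> base.span (monomial_multiples i H)"
  using assms by (intro scale_in_span_monoms monomial_multiplesI) (auto simp: homogeneous_polys_def)

lemma monomial_multiples_subset_span: "base.span (monomial_multiples i H) \<subseteq> span H"
  by (intro base.span_minimal base_subspace_span subsetI) (auto elim!: monomial_multiplesE intro: span_scale span_base)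

lemma graded_component_eq:
  assumes "finite G" "G \<subseteq> Mg a" "span G = UNIV"
  shows "Mg z = (if z < a then {0} else base.span (monomial_multiples (nat (z - a)) G))"
proof (intro equalityI subsetI)
  fix m assume m: "m \<in> Mg z"
  have "m \<in> span G" using assms(3) by simp
  then obtain p where p: "m = (\<Sum>g\<in>G. scale (p g) g)"
    unfolding span_finite[OF assms(1)] by blast
  show "m \<in> (if z < a then {0} else base.span (monomial_multiples (nat (z - a)) G))"
  proof (cases "z < a")
    case True
    then show ?thesis using homogeneous_decomposition[OF assms(1,2) p m] by simp
  next
    case False
    have "m = (\<Sum>g\<in>G. scale (hcomp (nat (z - a)) (p g)) g)"
      using homogeneous_decomposition[OF assms(1,2) p m] False by simp
    also have "\<dots> \<in> base.span (monomial_multiples (nat (z - a)) G)"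
      by (intro base.span_sum homogeneous_scale_in_span hcomp_homogeneous)
    finally show ?thesis using False by simp
  qed
next
  fix m assume m: "m \<in> (if z < a then {0} else base.span (monomial_multiples (nat (z - a)) G))"
  show "m \<in> Mg z"
  proof (cases "z < a")
    case True
    then show ?thesis using m graded_zero by simp
  next
    case False
    have "mono_scale t g \<in> Mg z" if "monom_degree t = nat (z - a)" "g \<in> G" for t g
      using graded_scale[of "Poly_Mapping.single t 1" "nat (z - a)" g a] that assms(2) False
      by (auto simp: homogeneous_polys_def)
    then have "monomial_multiples (nat (z - a)) G \<subseteq> Mg z"
      by (auto elim!: monomial_multiplesE)
    then have "base.span (monomial_multiples (nat (z - a)) G) \<subseteq> Mg z"
      by (rule base.span_minimal[OF _ base_subspace_Mg])
    then show ?thesis using m False by auto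
  qed
qed

text \<open>
  The leading monomials of the ideal \<open>(span H : g)\<close>, described degree by degree through
  linear algebra over the ground field. The monomials outside index the basis elements that \<open>g\<close> adds to \<open>span H\<close>.
\<close>

definition lead_set :: "'m set \<Rightarrow> 'm \<Rightarrow> ('v \<Rightarrow>\<^sub>0 nat) set" where
  "lead_set H g = {t. mono_scale t g \<in> base.span (monomial_multiples (monom_degree t) H \<union>
     (\<lambda>s. mono_scale s g) ` {s \<in> {s. monom_degree s = monom_degree t}. weight s < weight t})}"

text \<open>Multiplication by a monomial is linear over the ground field and preserves equality of
  degrees and the order of weights. Hence Dickson's lemma applies to
  \<open>lead_set\<close>.\<close>

lemma lead_set_add:
  assumes "t \<in> lead_set H g"
  shows "t + u \<in> lead_set H g"
proof -
  let ?S = "\<lambda>t. monomial_multiples (monom_degree t) H \<union>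
     (\<lambda>s. mono_scale s g) ` {s \<in> {s. monom_degree s = monom_degree t}. weight s < weight t}"
  have "mono_scale u (mono_scale t g) \<in> base.span (mono_scale u ` ?S t)"
    using assms unfolding lead_set_def by (intro base_span_mono_scale) auto
  moreover have "mono_scale u ` ?S t \<subseteq> ?S (t + u)"
  proof
    fix x assume "x \<in> mono_scale u ` ?S t"
    then obtain y where y: "x = mono_scale u y" "y \<in> ?S t" by blast
    from y(2) show "x \<in> ?S (t + u)"
    proof
      assume "y \<in> monomial_multiples (monom_degree t) H"
      then obtain s h where "y = mono_scale s h" "monom_degree s = monom_degree t" "h \<in> H"
        by (rule monomial_multiplesE)
      then have "x = mono_scale (u + s) h" "monom_degree (u + s) = monom_degree (t + u)" "h \<in> H"
        unfolding y(1) by (simp_all add: mono_scale_add monom_degree_add del: scale_scale)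
      then have "x \<in> monomial_multiples (monom_degree (t + u)) H"
        using monomial_multiplesI by blast
      then show ?thesis by blast
    next
      assume "y \<in> (\<lambda>s. mono_scale s g) ` {s \<in> {s. monom_degree s = monom_degree t}. weight s < weight t}"
      then obtain s where s: "y = mono_scale s g" "monom_degree s = monom_degree t" "weight s < weight t" by auto
      then have "x = mono_scale (u + s) g" "monom_degree (u + s) = monom_degree (t + u)" "weight (u + s) < weight (t + u)"
        unfolding y(1) by (simp_all add: mono_scale_add monom_degree_add weight_add del: scale_scale)
      then show ?thesis by blast
    qed
  qed
  ultimately have "mono_scale (u + t) g \<in> base.span (?S (t + u))"
    unfolding mono_scale_add using base.span_mono by blast
  then show ?thesis unfolding lead_set_def by (simp add: add.commute)
qed

text \<open>Membership is a linear relation over the ground field; its terms in \<open>g\<close>,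
  collected on one side, form a polynomial with leading monomial \<open>t\<close>.\<close>

lemma lead_set_imp_poly:
  assumes "t \<in> lead_set H g"
  obtains q where "q \<noteq> 0" "lead q = t" "scale q g \<in> span H"
proof -
  let ?T = "{s \<in> {s. monom_degree s = monom_degree t}. weight s < weight t}"
  obtain y1 y2 where y: "mono_scale t g = y1 + y2" "y1 \<in> base.span (monomial_multiples (monom_degree t) H)"
    "y2 \<in> base.span ((\<lambda>s. mono_scale s g) ` ?T)"
    using assms unfolding lead_set_def base.span_Un by auto
  have "\<exists>r. Poly_Mapping.keys r \<subseteq> ?T \<and> y2 = scale r g"
    using y(3)
  proof (induction rule: base.span_induct_alt)
    case base
    show ?case by (intro exI[of _ 0]) simp
  next
    case (step c x y)
    then obtain r s where rs: "Poly_Mapping.keys r \<subseteq> ?T" "y = scale r g" "s \<in> ?T" "x = mono_scale s g" by blast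
    then have "scale (Poly_Mapping.single 0 c) x + y = scale (Poly_Mapping.single s c + r) g"
      by (simp add: scale_left_distrib mult_single)
    moreover have "Poly_Mapping.keys (Poly_Mapping.single s c + r) \<subseteq> ?T"
      using rs(1,3) keys_add[of "Poly_Mapping.single s c" r] by (auto split: if_splits)
    ultimately show ?case by blast
  qed
  then obtain r where r: "Poly_Mapping.keys r \<subseteq> ?T" "y2 = scale r g" by blast
  define q where "q = Poly_Mapping.single t 1 - r"
  have "t \<notin> Poly_Mapping.keys r" using r(1) by auto
  then have t: "t \<in> Poly_Mapping.keys q"
    by (simp add: q_def in_keys_iff lookup_minus)
  have "lead q = t"
    using t
  proof (rule lead_eqI)
    fix s assume "s \<in> Poly_Mapping.keys q"
    then have "s = t \<or> s \<in> Poly_Mapping.keys r"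
      by (auto simp: q_def in_keys_iff lookup_minus lookup_single when_def split: if_splits)
    then show "weight s \<le> weight t" using r(1) by auto
  qed
  moreover have "scale q g = y1" by (simp add: q_def scale_left_diff_distrib y(1) r(2))
  then have "scale q g \<in> span H" using y(2) monomial_multiples_subset_span by blast
  moreover have "q \<noteq> 0" using t by auto
  ultimately show ?thesis using that by blast
qed

text \<open>As \<open>g\<close> and \<open>H\<close> lie in the same degree, a homogeneous component
  of the relation for \<open>q\<close> is again a relation. Dividing by its leading coefficient
  gives the linear relation that \<open>lead_set\<close> asks for.\<close>

lemma poly_imp_lead_set:
  assumes "finite H" "H \<subseteq> Mg a" "g \<in> Mg a" "g \<notin> H" and q: "q \<noteq> 0" "scale q g \<in> span H"
  shows "lead_set H g \<noteq> {}"
proof -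
  obtain p where p: "scale q g = (\<Sum>h\<in>H. scale (p h) h)"
    using q(2) unfolding span_finite[OF assms(1)] by blast
  \<comment> \<open>The order by weight does not refine the degree, so \<open>i\<close> need not be
    the largest degree in \<open>q\<close>. This component keeps the leading monomial.\<close>
  define i where "i = monom_degree (lead q)"
  define q' where "q' = hcomp i q"
  define f where "f = (\<lambda>h. if h = g then q else - p h)"
  have "(\<Sum>h\<in>H. scale (f h) h) = - (\<Sum>h\<in>H. scale (p h) h)"
    unfolding f_def sum_negf[symmetric] using assms(4) by (intro sum.cong) auto
  then have "(\<Sum>h\<in>insert g H. scale (f h) h) = 0"
    using assms(1,4) p by (simp add: f_def)
  then have "(\<Sum>h\<in>insert g H. scale (hcomp i (f h)) h) = 0"
    using assms by (intro homogeneous_relation) auto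
  then have "scale q' g = - (\<Sum>h\<in>H. scale (hcomp i (f h)) h)"
    using assms(1,4) by (simp add: q'_def f_def eq_neg_iff_add_eq_0)
  moreover have "(\<Sum>h\<in>H. scale (hcomp i (f h)) h) \<in> base.span (monomial_multiples i H)"
    by (intro base.span_sum homogeneous_scale_in_span hcomp_homogeneous)
  ultimately have q'g: "scale q' g \<in> base.span (monomial_multiples i H)"
    by (simp add: base.span_neg)
  define t where "t = lead q"
  have "Poly_Mapping.lookup q' t \<noteq> 0"
    using lead_in_keys[OF q(1)] by (simp add: q'_def t_def lookup_hcomp i_def in_keys_iff)
  define c where "c = Poly_Mapping.lookup q' t"
  let ?S = "monomial_multiples i H \<union> (\<lambda>s. mono_scale s g) ` {s \<in> {s. monom_degree s = i}. weight s < weight t}"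
  define r where "r = q' - Poly_Mapping.single t c"
  have "scale r g \<in> base.span ?S"
  proof (rule scale_in_span_monoms)
    fix s assume "s \<in> Poly_Mapping.keys r"
    then have s: "s \<noteq> t" "Poly_Mapping.lookup q' s \<noteq> 0"
      by (auto simp: r_def in_keys_iff lookup_minus lookup_single c_def when_def split: if_splits)
    then have "monom_degree s = i" "s \<in> Poly_Mapping.keys q"
      by (auto simp: q'_def lookup_hcomp in_keys_iff split: if_splits)
    moreover have "weight s < weight t"
      using lead_max[OF calculation(2)] s(1) by (simp add: t_def weight_inj order_less_le)
    ultimately show "mono_scale s g \<in> ?S" by blast
  qed
  moreover have "scale q' g \<in> base.span ?S"
    using q'g base.span_mono by blast
  ultimately have "scale q' g - scale r g \<in> base.span ?S"
    by (intro base.span_diff)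
  then have "scale (Poly_Mapping.single t c) g \<in> base.span ?S"
    by (simp add: r_def scale_left_diff_distrib)
  then have "scale (Poly_Mapping.single 0 (1 / c)) (scale (Poly_Mapping.single t c) g) \<in> base.span ?S"
    by (rule base.span_scale)
  then have "mono_scale t g \<in> base.span ?S"
    using \<open>Poly_Mapping.lookup q' t \<noteq> 0\<close> by (simp add: mult_single c_def)
  then have "t \<in> lead_set H g" unfolding lead_set_def by (simp add: t_def i_def)
  then show ?thesis by blast
qed

section \<open>Cumulative Hilbert function of a span, with the generators placed in degree 0\<close>

definition dim_sum :: "'m set \<Rightarrow> nat \<Rightarrow> nat" where
  "dim_sum H n = (\<Sum>i\<le>n. base.dim (monomial_multiples i H))"

text \<open>\<open>dim_Un_image\<close> in each degree, with monomials ordered by weight: a multiple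
  of \<open>g\<close> adds a dimension exactly when its monomial is outside
  \<open>lead_set H g\<close>.\<close>

lemma dim_sum_insert:
  assumes "finite H"
  shows "dim_sum (insert g H) n = dim_sum H n + cocount (lead_set H g) n"
proof -
  have "base.dim (monomial_multiples i (insert g H)) =
      base.dim (monomial_multiples i H) + card {t. monom_degree t = i \<and> t \<notin> lead_set H g}" for i
  proof -
    have "inj_on weight {t :: 'v \<Rightarrow>\<^sub>0 nat. monom_degree t = i}" by (simp add: inj_on_def weight_inj)
    from base.dim_Un_image[OF finite_monomial_multiples[OF assms] finite_monom_degree_eq this,
        of i "\<lambda>t. mono_scale t g"]
    have "base.dim (monomial_multiples i (insert g H)) = base.dim (monomial_multiples i H) +
      card {t \<in> {t. monom_degree t = i}. mono_scale t g \<notin> base.span (monomial_multiples i H \<union>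
        (\<lambda>t. mono_scale t g) ` {s \<in> {t. monom_degree t = i}. weight s < weight t})}"
      unfolding monomial_multiples_insert .
    moreover have "{t \<in> {t. monom_degree t = i}. mono_scale t g \<notin> base.span (monomial_multiples i H \<union>
        (\<lambda>t. mono_scale t g) ` {s \<in> {t. monom_degree t = i}. weight s < weight t})}
      = {t. monom_degree t = i \<and> t \<notin> lead_set H g}"
      unfolding lead_set_def by auto
    ultimately show ?thesis by simp
  qed
  moreover have "cocount (lead_set H g) n = (\<Sum>i\<le>n. card {t. monom_degree t = i \<and> t \<notin> lead_set H g})"
  proof -
    have "{t. monom_degree t \<le> n \<and> t \<notin> lead_set H g} = (\<Union>i\<le>n. {t. monom_degree t = i \<and> t \<notin> lead_set H g})"
      by auto
    then show ?thesis unfolding cocount_def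
      by (simp, intro card_UN_disjoint) (auto intro: finite_subset[OF _ finite_monom_degree_eq])
  qed
  ultimately show ?thesis unfolding dim_sum_def by (simp add: sum.distrib)
qed

lemma independent_insert_annihilator:
  assumes "finite B" "b \<notin> B" "independent (insert b B)" "scale q b \<in> span B"
  shows "q = 0"
proof -
  obtain p where p: "scale q b = (\<Sum>h\<in>B. scale (p h) h)"
    using assms(4) unfolding span_finite[OF assms(1)] by blast
  define f where "f = (\<lambda>h. if h = b then q else - p h)"
  have "(\<Sum>h\<in>B. scale (f h) h) = - (\<Sum>h\<in>B. scale (p h) h)"
    unfolding f_def sum_negf[symmetric] using assms(2) by (intro sum.cong) auto
  then have "(\<Sum>h\<in>insert b B. scale (f h) h) = 0"
    using assms(1,2) p by (simp add: f_def)
  then have "f b = 0"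
    using independentD[OF assms(3), of "insert b B" f b] assms(1) by simp
  then show ?thesis by (simp add: f_def)
qed

text \<open>No nonzero polynomial sends a new basis element into the span of the earlier ones, so
  every \<open>lead_set\<close> is empty and each element contributes all monomials.\<close>

lemma dim_sum_independent:
  assumes "finite B" "independent B"
  shows "dim_sum B n = card B * ((n + CARD('v)) choose CARD('v))"
  using assms
proof (induction B rule: finite_induct)
  case empty
  have "monomial_multiples i {} = {}" for i by (simp add: monomial_multiples_def)
  then show ?case by (simp add: dim_sum_def base.dim_eq_card_independent base.independent_empty)
next
  case (insert b B)
  have "lead_set B b = {}"
    using lead_set_imp_poly independent_insert_annihilator[OF insert.hyps insert.prems] by blast
  moreover have "independent B" using insert.prems independent_mono by blast
  ultimately show ?case
    using insert.IH insert.hyps by (simp add: dim_sum_insert cocount_empty)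
qed

text \<open>The hypothesis makes the ideal \<open>(span B : g)\<close> the whole ring or of height
  at least two. Over a free module such an ideal yields no new elements, by the divisibility lemma
  applied to each coordinate of \<open>p g\<close>.\<close>

lemma in_span_if_codim_2:
  assumes "torsion_free" "finite B" "independent B"
    and q: "\<And>x. \<exists>q. q \<noteq> 0 \<and> Poly_Mapping.lookup (lead q) x = 0 \<and> scale q g \<in> span B"
  shows "g \<in> span B"
proof -
  obtain p where p: "p \<noteq> 0" "scale p g \<in> span B" using q by blast
  then obtain u where u: "scale p g = (\<Sum>b\<in>B. scale (u b) b)"
    unfolding span_finite[OF assms(2)] by blast
  have "p dvd u b" if b: "b \<in> B" for b
  proof (rule poly_dvd_if_cofactors_dvd[OF p(1)])
    fix x
    obtain q where q: "q \<noteq> 0" "Poly_Mapping.lookup (lead q) x = 0" "scale q g \<in> span B" using q by blast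
    then obtain v where v: "scale q g = (\<Sum>b\<in>B. scale (v b) b)"
      unfolding span_finite[OF assms(2)] by blast
    \<comment> \<open>Both sums expand \<open>p q g\<close> in the basis \<open>B\<close>, so their
      coefficients agree.\<close>
    have "(\<Sum>b\<in>B. scale (q * u b - p * v b) b) = scale q (\<Sum>b\<in>B. scale (u b) b) - scale p (\<Sum>b\<in>B. scale (v b) b)"
      by (simp add: scale_left_diff_distrib sum_subtractf scale_sum_right)
    also have "\<dots> = 0" unfolding u[symmetric] v[symmetric] by (simp add: mult.commute)
    finally have "q * u b - p * v b = 0"
      using independentD[OF assms(3,2) subset_refl _ b, of "\<lambda>b. q * u b - p * v b"] by simp
    then have "p dvd q * u b" by simp
    with q show "\<exists>q. q \<noteq> 0 \<and> Poly_Mapping.lookup (lead q) x = 0 \<and> p dvd q * u b" by blast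
  qed
  then have "\<forall>b\<in>B. \<exists>w. u b = p * w" unfolding dvd_def by blast
  from bchoice[OF this] obtain w where w: "\<forall>b\<in>B. u b = p * w b" by blast
  have "scale p (g - (\<Sum>b\<in>B. scale (w b) b)) = 0"
    by (simp add: scale_right_diff_distrib u scale_sum_right w)
  then have "g - (\<Sum>b\<in>B. scale (w b) b) = 0"
    using assms(1) p(1) unfolding torsion_free_def by blast
  then have "g = (\<Sum>b\<in>B. scale (w b) b)" by simp
  then show ?thesis by (simp add: span_sum span_scale span_base)
qed

text \<open>Each new generator is torsion modulo \<open>span B\<close>, so it leaves
  \<open>c 0\<close> alone and adds a nonpositive amount to \<open>c 1\<close>.\<close>

lemma dim_sum_hpoly:
  assumes tf: "torsion_free" and B: "finite B" "independent B" "B \<subseteq> Mg a"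
    and "finite E" "E \<subseteq> Mg a" "\<And>g. g \<in> E \<Longrightarrow> \<exists>p. p \<noteq> 0 \<and> scale p g \<in> span B"
  shows "\<exists>c. (\<forall>\<^sub>F n in sequentially. int (dim_sum (B \<union> E) n) = hpoly CARD('v) c n) \<and>
    c 0 = int (card B) \<and> c 1 \<le> 0 \<and> (c 1 = 0 \<longrightarrow> E \<subseteq> span B)"
  using assms(5-7)
proof (induction E rule: finite_induct)
  case empty
  have "\<forall>\<^sub>F n in sequentially. int (dim_sum (B \<union> {}) n) = hpoly CARD('v) (\<lambda>i. if i = 0 then int (card B) else 0) n"
    by (simp add: dim_sum_independent[OF B(1,2)] hpoly_binomial)
  then show ?case by (intro exI[of _ "\<lambda>i. if i = 0 then int (card B) else 0"]) simp
next
  case (insert g E)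
  then obtain c where c: "\<forall>\<^sub>F n in sequentially. int (dim_sum (B \<union> E) n) = hpoly CARD('v) c n"
    "c 0 = int (card B)" "c 1 \<le> 0" "c 1 = 0 \<Longrightarrow> E \<subseteq> span B" by auto
  show ?case
  proof (cases "g \<in> B \<union> E")
    case True
    then have "g \<in> span B" using insert.hyps(2) by (auto intro: span_base)
    moreover have "B \<union> insert g E = B \<union> E" using True by auto
    ultimately show ?thesis using c by auto
  next
    case False
    obtain p where p: "p \<noteq> 0" "scale p g \<in> span B" using insert.prems by blast
    then have "scale p g \<in> span (B \<union> E)" using span_mono[of B "B \<union> E"] by blast
    then obtain s where "s \<in> lead_set (B \<union> E) g"
      using poly_imp_lead_set[of "B \<union> E" a g p] False p(1) B insert by auto
    with lead_set_add obtain e where e: "\<forall>\<^sub>F n in sequentially. int (cocount (lead_set (B \<union> E) g) n) = hpoly CARD('v) e n"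
      "e 0 = 0" "e 1 \<le> 0" "e 1 = 0 \<longrightarrow> (\<forall>x. \<exists>t\<in>lead_set (B \<union> E) g. Poly_Mapping.lookup t x = 0)"
      by (rule cocount_hpoly)
    have "\<forall>\<^sub>F n in sequentially. int (dim_sum (B \<union> insert g E) n) = hpoly CARD('v) (\<lambda>i. c i + e i) n"
      using c(1) e(1) by eventually_elim (simp add: dim_sum_insert B(1) insert.hyps(1) hpoly_add)
    \<comment> \<open>Two nonpositive numbers with sum 0 both vanish. The induction hypothesis then
      keeps the span equal to the free module \<open>span B\<close>, where the codimension argument
      applies to \<open>g\<close>.\<close>
    moreover have "insert g E \<subseteq> span B" if "c 1 + e 1 = 0"
    proof -
      have E: "E \<subseteq> span B" and t: "\<And>x. \<exists>t\<in>lead_set (B \<union> E) g. Poly_Mapping.lookup t x = 0"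
        using that c(3,4) e(3,4) by auto
      have "span (B \<union> E) = span B"
        using E span_superset[of B] span_superset[of "B \<union> E"] by (simp add: span_eq)
      then have "\<exists>q. q \<noteq> 0 \<and> Poly_Mapping.lookup (lead q) x = 0 \<and> scale q g \<in> span B" for x
        using t[of x] lead_set_imp_poly by metis
      then have "g \<in> span B" by (rule in_span_if_codim_2[OF tf B(1,2)])
      with E show ?thesis by simp
    qed
    ultimately show ?thesis using c(2,3) e(2,3) by (intro exI[of _ "\<lambda>i. c i + e i"]) auto
  qed
qed

section \<open>From \<open>dim_sum\<close> to the Hilbert coefficients\<close>

lemma hilbert_sum_eq:
  assumes "finite G" "G \<subseteq> Mg a" "span G = UNIV" "a \<ge> 0" "n \<ge> nat a"
  shows "hilbert_sum n = dim_sum G (n - nat a)"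
proof -
  note Mg = graded_component_eq[OF assms(1-3)]
  have sub: "{j. j \<le> int n \<and> Mg j \<noteq> {0}} \<subseteq> {a..int n}"
  proof
    fix j assume "j \<in> {j. j \<le> int n \<and> Mg j \<noteq> {0}}"
    then show "j \<in> {a..int n}" using Mg[of j] by (cases "j < a") auto
  qed
  have "base.dim {0} = 0" using base.dim_span[of "{}"] base.dim_eq_card_independent[OF base.independent_empty] by simp
  then have "hilbert_sum n = (\<Sum>j\<in>{a..int n}. base.dim (Mg j))"
    unfolding hilbert_sum_def using sub by (intro sum.mono_neutral_left) auto
  also have "\<dots> = (\<Sum>i\<le>n - nat a. base.dim (Mg (int i + a)))"
    using assms(4,5)
    by (intro sum.reindex_bij_witness[of _ "\<lambda>i. int i + a" "\<lambda>j. nat (j - a)"]) auto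
  also have "\<dots> = dim_sum G (n - nat a)"
    unfolding dim_sum_def using Mg by simp
  finally show ?thesis .
qed

lemma hilbert_coeff_eqI:
  assumes "\<forall>\<^sub>F n in sequentially. int (hilbert_sum n) = hpoly CARD('v) e n" "i \<le> CARD('v)"
  shows "hilbert_coeff i = e i"
proof -
  \<comment> \<open>Cut off above \<open>CARD('v)\<close> to meet the normalisation in
    \<open>hilbert_coeff\<close>.\<close>
  define e' where "e' = (\<lambda>i. if i \<le> CARD('v) then e i else 0)"
  have coeffs: "hilbert_coeffs f \<longleftrightarrow> (\<forall>\<^sub>F n in sequentially. int (hilbert_sum n) = hpoly CARD('v) f n)" for f
    unfolding hilbert_coeffs_def hpoly_def ..
  have "hilbert_coeff = e'"
    unfolding hilbert_coeff_def
  proof (rule the_equality)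
    have "hpoly CARD('v) e' n = hpoly CARD('v) e n" for n
      by (rule hpoly_cong) (simp add: e'_def)
    then show "hilbert_coeffs e' \<and> (\<forall>i>CARD('v). e' i = 0)"
      using assms(1) by (simp add: coeffs e'_def)
  next
    fix f assume f: "hilbert_coeffs f \<and> (\<forall>i>CARD('v). f i = 0)"
    then have "\<forall>\<^sub>F n in sequentially. hpoly CARD('v) (\<lambda>i. f i - e i) n = 0"
      using assms(1) unfolding coeffs by (auto elim: eventually_elim2 simp: hpoly_diff)
    then have "f i = e i" if "i \<le> CARD('v)" for i
      using hpoly_eventually_zero that by fastforce
    then show "f = e'" unfolding e'_def using f by (auto simp: fun_eq_iff not_le)
  qed
  then show ?thesis using assms(2) by (simp add: e'_def)
qed

lemma hilbert_coeff_eq_if_dim_sum: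
  assumes "finite G" "G \<subseteq> Mg a" "span G = UNIV" "a \<ge> 0"
    and "\<forall>\<^sub>F n in sequentially. int (dim_sum G n) = hpoly CARD('v) c n"
  shows "hilbert_coeff 0 = c 0" "hilbert_coeff 1 = c 1 + a * c 0"
proof -
  obtain e where e: "e 0 = c 0" "e 1 = c 1 + int (nat a) * c 0"
    "\<forall>\<^sub>F n in sequentially. int (dim_sum G (n - nat a)) = hpoly CARD('v) e n"
    using assms(5) by (rule eventually_hpoly_shift)
  have "\<forall>\<^sub>F n in sequentially. int (hilbert_sum n) = hpoly CARD('v) e n"
    using e(3) eventually_ge_at_top[of "nat a"]
    by eventually_elim (simp add: hilbert_sum_eq[OF assms(1-4)])
  then have "hilbert_coeff i = e i" if "i \<le> CARD('v)" for i
    using hilbert_coeff_eqI that by blast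
  moreover have "1 \<le> CARD('v)" using zero_less_card_finite[where 'a='v] by linarith
  ultimately show "hilbert_coeff 0 = c 0" "hilbert_coeff 1 = c 1 + a * c 0"
    using e(1,2) assms(4) by simp_all
qed

text \<open>Adjoining \<open>g\<close> to a maximal independent \<open>B\<close> creates a relation,
  and independence of \<open>B\<close> makes its coefficient at \<open>g\<close> nonzero. Over a
  ring this only puts a multiple of \<open>g\<close> into \<open>span B\<close>.\<close>

lemma maximal_independent:
  assumes "finite G"
  obtains B where "B \<subseteq> G" "independent B" "\<forall>g\<in>G. \<exists>p. p \<noteq> 0 \<and> scale p g \<in> span B"
proof -
  have "finite {B. B \<subseteq> G \<and> independent B}" using assms by simp
  moreover have "{} \<in> {B. B \<subseteq> G \<and> independent B}" by (simp add: independent_empty)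
  ultimately obtain B where B: "B \<subseteq> G" "independent B"
    and max: "\<And>B'. B' \<subseteq> G \<Longrightarrow> independent B' \<Longrightarrow> B \<subseteq> B' \<Longrightarrow> B = B'"
    using finite_has_maximal[of "{B. B \<subseteq> G \<and> independent B}"] by (smt (verit) empty_iff mem_Collect_eq)
  have fin: "finite B" using B(1) assms finite_subset by blast
  have "\<exists>p. p \<noteq> 0 \<and> scale p g \<in> span B" if g: "g \<in> G" for g
  proof (cases "g \<in> B")
    case True
    then show ?thesis by (intro exI[of _ 1]) (simp add: span_base)
  next
    case False
    then have "dependent (insert g B)" using max[of "insert g B"] B(1) g by blast
    then obtain u where u: "(\<Sum>v\<in>insert g B. scale (u v) v) = 0" "\<exists>v\<in>insert g B. u v \<noteq> 0"
      using dependent_finite[of "insert g B"] fin by auto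
    have eq: "scale (u g) g + (\<Sum>v\<in>B. scale (u v) v) = 0" using u(1) fin False by simp
    have "u g \<noteq> 0"
    proof
      assume 0: "u g = 0"
      then have "(\<Sum>v\<in>B. scale (u v) v) = 0" using eq by simp
      then have "\<forall>v\<in>B. u v = 0" using independentD[OF B(2) fin subset_refl] by blast
      then show False using u(2) 0 by auto
    qed
    moreover have "scale (u g) g = - (\<Sum>v\<in>B. scale (u v) v)" using eq by (simp add: eq_neg_iff_add_eq_0)
    then have "scale (u g) g \<in> span B" by (simp add: span_neg span_sum span_scale span_base)
    ultimately show ?thesis by blast
  qed
  with B that show ?thesis by blast
qed

text \<open>Independence over the ground field makes the generating set minimal, as the Nakayama
  argument requires.\<close>

lemma finite_base_independent_generators:
  assumes "finitely_generated" "generated_in_degree a"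
  obtains G where "finite G" "G \<subseteq> Mg a" "base.independent G" "span G = UNIV"
proof -
  obtain S where S: "finite S" "span S = UNIV" using assms(1) unfolding finitely_generated_def by blast
  have "\<exists>T. finite T \<and> T \<subseteq> Mg a \<and> s \<in> span T" for s
  proof -
    have "s \<in> span (Mg a)" using assms(2) unfolding generated_in_degree_def by simp
    then obtain T r where "finite T" "T \<subseteq> Mg a" "s = (\<Sum>v\<in>T. scale (r v) v)"
      unfolding span_explicit by blast
    then show ?thesis by (intro exI[of _ T]) (simp add: span_sum span_scale span_base)
  qed
  then obtain T where T: "\<And>s. finite (T s)" "\<And>s. T s \<subseteq> Mg a" "\<And>s. s \<in> span (T s)" by metis
  define G where "G = (\<Union>s\<in>S. T s)"
  obtain G' where G': "G' \<subseteq> G" "base.independent G'" "G \<subseteq> base.span G'"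
    using base.maximal_independent_subset by blast
  have "base.span G' \<subseteq> span G'"
    by (intro base.span_minimal base_subspace_span span_superset)
  then have "span G \<subseteq> span G'"
    using G'(3) by (intro span_minimal) auto
  moreover have "S \<subseteq> span G"
    using T(3) span_mono[of "T _" G] unfolding G_def by blast
  then have "span S \<subseteq> span G" by (intro span_minimal) auto
  ultimately have "span G' = UNIV" using S(2) by auto
  moreover have "finite G'" "G' \<subseteq> Mg a"
    using G'(1) S(1) T(1,2) finite_subset[of G' G] unfolding G_def by auto
  ultimately show ?thesis using that G'(2) by blast
qed

text \<open>
  A graded form of Nakayama's lemma. Let \<open>q\<close> and \<open>p\<close> be the transition matrices from \<open>G\<close> to a basis and
  back. A relation \<open>y\<close> among the elements of \<open>G\<close> satisfies \<open>y q = 0\<close>, hence \<open>y = y (1 - q p)\<close>, and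
  \<open>1 - q p\<close> has no constant terms by minimality of \<open>G\<close>. So \<open>y\<close> vanishes to arbitrarily high order.
\<close>

lemma independent_if_free:
  assumes "free" and G: "finite G" "G \<subseteq> Mg a" "base.independent G" "span G = UNIV"
  shows "independent G"
proof -
  obtain C where C: "independent C" "span C = UNIV" using assms(1) unfolding free_def by blast
  define q where "q = (\<lambda>h. representation C h)"
  \<comment> \<open>The basis \<open>C\<close> need be neither finite nor homogeneous; only the
    finitely many elements occurring in coordinates of \<open>G\<close> matter.\<close>
  define C' where "C' = (\<Union>h\<in>G. {c. q h c \<noteq> 0})"
  have finC: "finite C'" unfolding C'_def q_def using G(1) finite_representation by auto
  have subC: "C' \<subseteq> C" unfolding C'_def q_def using representation_ne_zero by auto
  have q: "(\<Sum>c\<in>C'. scale (q h c) c) = h" if "h \<in> G" for h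
  proof -
    have "(\<Sum>c\<in>C'. scale (q h c) c) = (\<Sum>c | q h c \<noteq> 0. scale (q h c) c)"
      using that finC by (intro sum.mono_neutral_right) (auto simp: C'_def)
    also have "\<dots> = h" unfolding q_def using sum_nonzero_representation_eq[OF C(1)] C(2) by simp
    finally show ?thesis .
  qed
  have "\<exists>p. c = (\<Sum>g\<in>G. scale (p g) g)" for c
    using G(4) span_finite[OF G(1)] by (metis (no_types, lifting) UNIV_I imageE)
  then obtain p where p: "\<And>c. c = (\<Sum>g\<in>G. scale (p c g) g)" by metis
  define R where "R = (\<lambda>h g. (if g = h then 1 else 0) - (\<Sum>c\<in>C'. q h c * p c g))"
  \<comment> \<open>Each row of \<open>R = 1 - q p\<close> is a relation among \<open>G\<close>. Its
    part of degree 0 is a relation over the ground field, hence trivial.\<close>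
  have R0: "Poly_Mapping.lookup (R h g) 0 = 0" if "h \<in> G" "g \<in> G" for h g
  proof -
    have "(\<Sum>g\<in>G. scale (R h g) g) =
        (\<Sum>g\<in>G. scale (if g = h then 1 else 0) g) - (\<Sum>g\<in>G. \<Sum>c\<in>C'. scale (q h c) (scale (p c g) g))"
      by (simp add: R_def scale_left_diff_distrib sum_subtractf scale_sum_left)
    also have "(\<Sum>g\<in>G. scale (if g = h then 1 else 0) g) = (\<Sum>g\<in>G. if g = h then h else 0)"
      by (intro sum.cong) auto
    also have "\<dots> = h" using that(1) G(1) by simp
    also have "(\<Sum>g\<in>G. \<Sum>c\<in>C'. scale (q h c) (scale (p c g) g)) = (\<Sum>c\<in>C'. scale (q h c) c)"
      by (subst sum.swap) (simp only: scale_sum_right[symmetric] p[symmetric])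
    finally have "(\<Sum>g\<in>G. scale (R h g) g) = 0" using q[OF that(1)] by simp
    then have "(\<Sum>g\<in>G. scale (hcomp 0 (R h g)) g) = 0"
      by (rule homogeneous_relation[OF G(1,2)])
    then show ?thesis
      unfolding hcomp_0 using base.independentD[OF G(3,1) subset_refl _ that(2), of "\<lambda>g. Poly_Mapping.lookup (R h g) 0"] by blast
  qed
  have "\<forall>g\<in>G. y g = 0" if y: "(\<Sum>g\<in>G. scale (y g) g) = 0" for y
  proof -
    have yq: "(\<Sum>h\<in>G. y h * q h c) = 0" if c: "c \<in> C'" for c
    proof -
      have "(\<Sum>c\<in>C'. scale (\<Sum>h\<in>G. y h * q h c) c) = (\<Sum>h\<in>G. scale (y h) (\<Sum>c\<in>C'. scale (q h c) c))"
        by (simp add: scale_sum_left scale_sum_right) (rule sum.swap)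
      also have "\<dots> = (\<Sum>h\<in>G. scale (y h) h)" by (intro sum.cong refl) (simp add: q)
      finally have "(\<Sum>c\<in>C'. scale (\<Sum>h\<in>G. y h * q h c) c) = 0" using y by simp
      then show ?thesis using independentD[OF C(1) finC subC _ c, of "\<lambda>c. \<Sum>h\<in>G. y h * q h c"] by blast
    qed
    have yR: "y g = (\<Sum>h\<in>G. y h * R h g)" if g: "g \<in> G" for g
    proof -
      have "(\<Sum>h\<in>G. y h * R h g) = (\<Sum>h\<in>G. y h * (if g = h then 1 else 0)) - (\<Sum>h\<in>G. \<Sum>c\<in>C'. (y h * q h c) * p c g)"
        by (simp add: R_def right_diff_distrib sum_subtractf sum_distrib_left mult.assoc)
      also have "(\<Sum>h\<in>G. y h * (if g = h then 1 else 0)) = (\<Sum>h\<in>G. if g = h then y h else 0)"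
        by (intro sum.cong) auto
      also have "\<dots> = y g" using g G(1) by simp
      also have "(\<Sum>h\<in>G. \<Sum>c\<in>C'. (y h * q h c) * p c g) = (\<Sum>c\<in>C'. (\<Sum>h\<in>G. y h * q h c) * p c g)"
        by (subst sum.swap) (simp add: sum_distrib_right)
      also have "\<dots> = 0" by (simp add: yq)
      finally show ?thesis by simp
    qed
    \<comment> \<open>Each use of \<open>y = y R\<close> raises the lower bound on degrees by one,
      since no entry of \<open>R\<close> has a constant term.\<close>
    have deg: "monom_degree t \<ge> k" if "g \<in> G" "t \<in> Poly_Mapping.keys (y g)" for k g t
      using that
    proof (induction k arbitrary: g t)
      case (Suc k)
      have "Poly_Mapping.lookup (\<Sum>h\<in>G. y h * R h g) t \<noteq> 0"
        using Suc.prems yR by (simp add: in_keys_iff)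
      then obtain h where h: "h \<in> G" "t \<in> Poly_Mapping.keys (y h * R h g)"
        unfolding lookup_sum in_keys_iff by (meson sum.not_neutral_contains_not_neutral)
      then obtain r s where rs: "t = r + s" "r \<in> Poly_Mapping.keys (y h)" "s \<in> Poly_Mapping.keys (R h g)"
        using keys_mult by fast
      have "s \<noteq> 0" using rs(3) R0[OF h(1) Suc.prems(1)] by (auto simp: in_keys_iff)
      then have "monom_degree s \<noteq> 0" by (simp add: monom_degree_eq_0_iff)
      then show ?case using Suc.IH[OF h(1) rs(2)] by (simp add: rs(1) monom_degree_add)
    qed simp
    have "Poly_Mapping.keys (y g) = {}" if "g \<in> G" for g
      using deg[OF that, of _ "Suc (monom_degree _)"] not_less_eq_eq by blast
    then show ?thesis by (simp add: keys_eq_empty)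
  qed
  then show ?thesis using dependent_finite[OF G(1)] by blast
qed

text \<open>The coefficient \<open>c 1\<close> for \<open>dim_sum G\<close> is exactly
  \<open>hilbert_coeff 1 - a * hilbert_coeff 0\<close>, so its sign and its vanishing decide both
  claims.\<close>

lemma hilbert_coeff_1_le:
  assumes "finitely_generated" "generated_in_degree a" "a \<ge> 0" "torsion_free"
  shows "hilbert_coeff 1 \<le> a * hilbert_coeff 0 \<and> (hilbert_coeff 1 = a * hilbert_coeff 0 \<longleftrightarrow> free)"
proof -
  obtain G where G: "finite G" "G \<subseteq> Mg a" "base.independent G" "span G = UNIV"
    using finite_base_independent_generators[OF assms(1,2)] .
  note coeff = hilbert_coeff_eq_if_dim_sum[OF G(1,2,4) assms(3)]
  obtain B where B: "B \<subseteq> G" "independent B" "\<forall>g\<in>G. \<exists>p. p \<noteq> 0 \<and> scale p g \<in> span B"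
    using maximal_independent[OF G(1)] .
  have "finite B" using B(1) G(1) finite_subset by blast
  then obtain c where c: "\<forall>\<^sub>F n in sequentially. int (dim_sum (B \<union> G) n) = hpoly CARD('v) c n"
    "c 1 \<le> 0" "c 1 = 0 \<Longrightarrow> G \<subseteq> span B"
    using dim_sum_hpoly[OF assms(4) _ B(2) _ G(1,2)] B(1,3) G(2) by blast
  have "B \<union> G = G" using B(1) by blast
  then have eq: "hilbert_coeff 0 = c 0" "hilbert_coeff 1 = c 1 + a * c 0"
    using coeff c(1) by auto
  have "free" if "hilbert_coeff 1 = a * hilbert_coeff 0"
  proof -
    have "G \<subseteq> span B" using that c(3) eq by simp
    then have "span G \<subseteq> span B" by (intro span_minimal) auto
    then have "span B = UNIV" using G(4) by auto
    then show ?thesis unfolding free_def using B(2) by blast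
  qed
  moreover have "hilbert_coeff 1 = a * hilbert_coeff 0" if "free"
  proof -
    have "independent G" using independent_if_free[OF that G] .
    then have "\<forall>\<^sub>F n in sequentially. int (dim_sum G n) = hpoly CARD('v) (\<lambda>i. if i = 0 then int (card G) else 0) n"
      by (simp add: dim_sum_independent[OF G(1)] hpoly_binomial)
    from coeff[OF this] show ?thesis by simp
  qed
  ultimately show ?thesis using eq c(2) by auto
qed

end

theorem corollary5p4:
  fixes scale :: "('v::finite, 'k::field) mpoly \<Rightarrow> 'm::ab_group_add \<Rightarrow> 'm"
    and Mg :: "int \<Rightarrow> 'm set" and a :: int
  assumes "CARD('v) \<ge> 2"
    and "graded_module scale Mg"
    and "graded_module.finitely_generated scale"
    and "(UNIV :: 'm set) \<noteq> {0}"
    and "a \<ge> 0"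
    and "graded_module.generated_in_degree scale Mg a"
    and "graded_module.torsion_free scale"
  shows "graded_module.hilbert_coeff scale Mg 1 \<le> a * graded_module.hilbert_coeff scale Mg 0 \<and>
    (graded_module.hilbert_coeff scale Mg 1 = a * graded_module.hilbert_coeff scale Mg 0
       \<longleftrightarrow> graded_module.free scale)"
  using graded_module.hilbert_coeff_1_le[OF assms(2,3,6,5,7)] .

end
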